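(* Let $n\geq 0$ be an integer and let $a_0,a_1,\dots,a_n$ be complex numbers, not all zero. Define \[ \phi_F(t)=e^{-2\pi\cosh t}\Bigg(\sum_{m=0}^{n}a_m e^{-2\pi m e^{t}}\Bigg)\Bigg(\sum_{m=0}^{n}\overline{a_m}\, e^{-2\pi m e^{-t}}\Bigg),\qquad t\in\mathbb{R}, \] the entire function $\Xi_F(s)=\int_{-\infty}^{\infty}\phi_F(t)e^{ist}\,dt$, and $C_F(s)=\Xi_F(-is)$. Let \[ \psi_F(s)=\pi^{-s}\sum_{m=0}^{n}a_m(2m+1)^{-s}, \] let $P(y)=\sum_{m=0}^{n}a_m y^m$, and let $k\geq 0$ be the integer such that $P(1)=P'(1)=\cdots=P^{(k-1)}(1)=0$ and $P^{(k)}(1)\neq 0$. Let $\Delta_*<\Delta_{**}$ be positive real numbers and suppose that $\psi_F(s-k)$ has no zeros in the strip $-\Delta_{**}<\operatorname{Re} s<\Delta_*$. Let $\delta$ satisfy $0<\delta<\Delta_*$. Then all but finitely many zeros of $C_F(s)$ lying in $|\operatorname{Re} s|\leq\delta$ are on the line $\operatorname{Re} s=0$ and are simple.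
   Context: The functions $\Xi_F$ are approximations (introduced by H. Ki) of the Ramanujan $\Xi$-function; $k$ is the order of vanishing of the polynomial $P$ at $y=1$. *)

theory Defs
  imports "HOL-Analysis.Analysis" "HOL-Computational_Algebra.Polynomial"
begin

definition phiF :: "(nat \<Rightarrow> complex) \<Rightarrow> nat \<Rightarrow> real \<Rightarrow> complex" where
  "phiF a n t =
     complex_of_real (exp (- 2 * pi * cosh t))
     * (\<Sum>m\<le>n. a m * complex_of_real (exp (- 2 * pi * real m * exp t)))
     * (\<Sum>m\<le>n. cnj (a m) * complex_of_real (exp (- 2 * pi * real m * exp (- t))))"

definition XiF :: "(nat \<Rightarrow> complex) \<Rightarrow> nat \<Rightarrow> complex \<Rightarrow> complex" where
  "XiF a n s = (LBINT t. phiF a n t * exp (\<i> * s * complex_of_real t))"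

definition CF :: "(nat \<Rightarrow> complex) \<Rightarrow> nat \<Rightarrow> complex \<Rightarrow> complex" where
  "CF a n s = XiF a n (- \<i> * s)"

definition psiF :: "(nat \<Rightarrow> complex) \<Rightarrow> nat \<Rightarrow> complex \<Rightarrow> complex" where
  "psiF a n s = complex_of_real pi powr (- s) * (\<Sum>m\<le>n. a m * of_nat (2 * m + 1) powr (- s))"

definition PF :: "(nat \<Rightarrow> complex) \<Rightarrow> nat \<Rightarrow> complex poly" where
  "PF a n = (\<Sum>m\<le>n. monom (a m) m)"

end

theory Submission
  imports Defs "HOL-Complex_Analysis.Complex_Analysis" "HOL-Real_Asymp.Real_Asymp"
begin

text \<open>
  Expanding the two sums in $\phi_F$ writes $C_F$ as a combination of modified Bessel integrals
  $\int \exp(-\alpha e^t - \beta e^{-t} + st)\,dt$. Each of them splits as $G(s) + \widetilde G(-s)$,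
  where $G(s) = \Gamma(s)\alpha^{-s}\,{}_0F_1(;1-s;\alpha\beta)$ and $\widetilde G$ has $\alpha$, $\beta$
  exchanged: all three functions solve the same three-term recurrence in $s$, and comparing Casorati
  determinants as $s \to \pm\infty$ identifies the solutions. Summation gives
  $C_F(s) = g(s) + \overline{g(-\bar s)}$ with $g(s) = (-1)^k\,\Gamma(s-k)\,h(s)$, and
  $h(s) = c\,\psi_F(s-k) + O(1/|\mathrm{Im}\, s|)$ with $c \neq 0$.

  An exponential sum without zeros in an open strip is bounded away from zero on closed substrips, so
  $h'/h$ is bounded there, whereas the real part of $\Gamma'/\Gamma$ tends to infinity with
  $|\mathrm{Im}\, s|$. Hence $\mathrm{Re}\,(g'/g) > 0$ high up in the strip. So $|g|$ increases strictly
  with the real part, which forces zeros of $C_F$ onto the imaginary axis; on the axis, a zero of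
  $C_F = 2\,\mathrm{Re}\, g$ has $C_F' = 2 g\,\mathrm{Re}\,(g'/g) \neq 0$.
\<close>

subsection \<open>Modified Bessel integrals\<close>

text \<open>On a coset s + Z the recurrence has a two-dimensional solution space, so by itself it
  leaves 1-periodic coefficients undetermined. Casorati determinants fix them: one step multiplies
  such a determinant by a constant, so its behaviour far to the right gives its value at s.
  First-order asymptotics suffice there, since the two Gamma factors, at s and at -s, multiply to an
  elementary expression by the reflection formula. The other direction comes for free from
  exchanging \<alpha> and \<beta>. The condition |Im s| >= 1 keeps every argument away from the
  poles of Gamma and the zeros of the Pochhammer symbols. Inside the strip, a bound on |Im s| leaves
  only a compact box, which holds finitely many zeros. The shift by k has this origin: the j-th term
  of the 0F1 series, summed over all pairs of frequencies, carries the factor sum of conj(a_l) (pi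
  (2l+1))^j, which vanishes for j < k and not for j = k. The first surviving term therefore carries
  Gamma(s) / ((1-s)...(k-s)) = (-1)^k Gamma(s-k).\<close>

lemma integral_exp_gamma_1:
  assumes "Re s > 0"
  shows "integrable lborel (\<lambda>t::real. exp (of_real (- exp t) + s * of_real t))"
    and "(LBINT t. exp (of_real (- exp t) + s * of_real t)) = Gamma s"
proof -
  \<comment> \<open>\<open>f\<close> is Euler's integrand for Gamma; \<open>h\<close> is what the
    substitution x = exp t makes of it.\<close>
  define f where "f = (\<lambda>t::real. complex_of_real t powr (s - 1) / of_real (exp t))"
  define h where "h = (\<lambda>t::real. exp (of_real (- exp t) + s * of_real t))"
  have img: "range (exp :: real \<Rightarrow> real) = {0<..}"
    by (auto simp: image_iff) (metis exp_ln)
  have eq: "\<bar>exp t\<bar> *\<^sub>R f (exp t) = h t" for t :: real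
    by (simp add: f_def h_def powr_def scaleR_conv_of_real exp_diff exp_add exp_minus
        exp_of_real [symmetric] divide_inverse algebra_simps flip: Ln_of_real)
  have "f absolutely_integrable_on range exp \<and> integral (range exp) f = Gamma s"
    unfolding img f_def
    using absolutely_integrable_Gamma_integral'[OF assms] Gamma_integral_complex'[OF assms]
    by (auto simp: integral_unique)
  then have *: "(\<lambda>t. \<bar>exp t\<bar> *\<^sub>R f (exp t)) absolutely_integrable_on UNIV \<and>
      integral UNIV (\<lambda>t. \<bar>exp t\<bar> *\<^sub>R f (exp t)) = Gamma s"
    by (subst has_absolute_integral_change_of_variables_real)
       (auto intro!: derivative_eq_intros inj_onI)
  have meas: "h \<in> borel_measurable lborel"
    unfolding h_def by measurable
  from * have 1: "set_integrable lebesgue UNIV h" "integral UNIV h = Gamma s"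
    unfolding eq by auto
  then show i: "integrable lborel (\<lambda>t. exp (of_real (- exp t) + s * of_real t))"
    using meas unfolding h_def by (simp add: set_integrable_def integrable_completion)
  show "(LBINT t. exp (of_real (- exp t) + s * of_real t)) = Gamma s"
    using integral_lborel[OF i] 1(2) by (simp add: h_def)
qed

text \<open>Translating t by ln \<alpha> absorbs the factor \<alpha>.\<close>

lemma integral_exp_gamma:
  fixes \<alpha> :: real
  assumes "Re s > 0" "\<alpha> > 0"
  shows "integrable lborel (\<lambda>t::real. exp (of_real (- \<alpha> * exp t) + s * of_real t))"
    and "(LBINT t. exp (of_real (- \<alpha> * exp t) + s * of_real t)) = Gamma s * exp (- s * of_real (ln \<alpha>))"
proof -
  define h where "h = (\<lambda>t::real. exp (of_real (- exp t) + s * of_real t))"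
  have eq: "exp (of_real (- \<alpha> * exp t) + s * of_real t) =
      h (ln \<alpha> + 1 * t) * exp (- s * of_real (ln \<alpha>))" for t
    using assms by (simp add: h_def exp_add [symmetric] algebra_simps) (simp add: exp_add mult.commute)
  note h = integral_exp_gamma_1[OF assms(1), folded h_def]
  show "integrable lborel (\<lambda>t::real. exp (of_real (- \<alpha> * exp t) + s * of_real t))"
    unfolding eq using lborel_integrable_real_affine[OF h(1), of 1 "ln \<alpha>"] by simp
  show "(LBINT t. exp (of_real (- \<alpha> * exp t) + s * of_real t)) = Gamma s * exp (- s * of_real (ln \<alpha>))"
    unfolding eq using lborel_integral_real_affine[of 1 h "ln \<alpha>"] h(2) by simp
qed

text \<open>Equals $2 (\beta/\alpha)^{s/2} K_s(2\sqrt{\alpha\beta})$.\<close>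

definition bessel_integral :: "real \<Rightarrow> real \<Rightarrow> complex \<Rightarrow> complex" where
  "bessel_integral \<alpha> \<beta> s = (LBINT t. exp (of_real (- \<alpha> * exp t - \<beta> * exp (- t)) + s * of_real t))"

lemma exp_neg_le_fact_div_power:
  fixes u :: real assumes "u > 0" shows "exp (- u) \<le> fact N / u ^ N"
proof -
  have "(\<Sum>j\<in>{N}. u ^ j /\<^sub>R fact j) \<le> (\<Sum>j. u ^ j /\<^sub>R fact j)"
    using assms by (intro sum_le_suminf summable_exp_generic) auto
  then have "u ^ N / fact N \<le> exp u"
    by (simp add: exp_def divide_inverse mult.commute)
  then show ?thesis using assms
    by (simp add: exp_minus field_simps)
qed

text \<open>For Re s <= 0 the decay at minus infinity has to come from exp (- \<beta> * exp (- t)).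
  This factor is at most a constant times exp (N * t), which moves s by N into the half-plane where
  the Gamma integral converges.\<close>

lemma integrable_bessel_integrand:
  fixes s :: complex
  assumes "\<alpha> > 0" "\<beta> > 0"
  shows "integrable lborel (\<lambda>t. exp (of_real (- \<alpha> * exp t - \<beta> * exp (- t)) + s * of_real t))"
proof -
  obtain N :: nat where N: "- Re s < real N" using reals_Archimedean2 by blast
  have "integrable lborel (\<lambda>t. of_real (fact N / \<beta> ^ N) *
     exp (of_real (- \<alpha> * exp t) + (s + of_nat N) * of_real t))"
    using integral_exp_gamma(1)[of "s + of_nat N" \<alpha>] assms N by simp
  then show ?thesis
  proof (rule Bochner_Integration.integrable_bound, goal_cases)
    case 1 show ?case by measurable
  next
    case 2
    have "norm (exp (of_real (- \<alpha> * exp t - \<beta> * exp (- t)) + s * of_real t)) \<le>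
      norm (of_real (fact N / \<beta> ^ N) * exp (of_real (- \<alpha> * exp t) + (s + of_nat N) * of_real t))" for t
    proof -
      have "exp (- (\<beta> * exp (-t))) \<le> fact N / (\<beta> * exp (-t)) ^ N"
        using assms by (intro exp_neg_le_fact_div_power) auto
      also have "\<dots> = fact N / \<beta> ^ N * exp (N * t)"
        using assms by (simp add: power_mult_distrib exp_of_nat_mult exp_minus field_simps flip: exp_of_nat2_mult)
      finally have "exp (- \<alpha> * exp t + Re s * t) * exp (- (\<beta> * exp (-t))) \<le>
          exp (- \<alpha> * exp t + Re s * t) * (fact N / \<beta> ^ N * exp (N * t))"
        by (intro mult_left_mono) auto
      also have "exp (- \<alpha> * exp t + Re s * t) * exp (- (\<beta> * exp (-t))) =
          norm (exp (of_real (- \<alpha> * exp t - \<beta> * exp (- t)) + s * of_real t))"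
        by (simp add: exp_add [symmetric])
      also have "exp (- \<alpha> * exp t + Re s * t) * (fact N / \<beta> ^ N * exp (N * t)) =
          norm (of_real (fact N / \<beta> ^ N) * exp (of_real (- \<alpha> * exp t) + (s + of_nat N) * of_real t))"
        using assms by (simp add: norm_mult norm_divide norm_power algebra_simps exp_add [symmetric])
      finally show ?thesis .
    qed
    then show ?case by simp
  qed
qed

lemma bessel_integral_swap: "bessel_integral \<alpha> \<beta> s = bessel_integral \<beta> \<alpha> (- s)"
proof -
  have "bessel_integral \<alpha> \<beta> s = (LBINT t. exp (of_real (- \<alpha> * exp (- t) - \<beta> * exp t) + s * of_real (- t)))"
    unfolding bessel_integral_def
    using lborel_integral_real_affine[of "-1" "\<lambda>t. exp (of_real (- \<alpha> * exp t - \<beta> * exp (- t)) + s * of_real t)" 0]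
    by simp
  also have "\<dots> = bessel_integral \<beta> \<alpha> (- s)"
    unfolding bessel_integral_def by (intro Bochner_Integration.integral_cong arg_cong[where f = exp]) auto
  finally show ?thesis .
qed

text \<open>Integration by parts: the integrand of the combination, \<open>g\<close> below, is the
  derivative of the kernel \<open>f s\<close>, which tends to 0 at both ends.\<close>

lemma bessel_integral_recurrence:
  assumes "\<alpha> > 0" "\<beta> > 0"
  shows "\<alpha> * bessel_integral \<alpha> \<beta> (s + 1) = s * bessel_integral \<alpha> \<beta> s + \<beta> * bessel_integral \<alpha> \<beta> (s - 1)"
proof -
  define f where "f = (\<lambda>s (t::real). exp (of_real (- \<alpha> * exp t - \<beta> * exp (- t)) + s * complex_of_real t))"
  define g where "g = (\<lambda>t. s * f s t + \<beta> * f (s - 1) t - \<alpha> * f (s + 1) t)"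
  have int: "integrable lborel (f s)" for s
    unfolding f_def using integrable_bessel_integrand[OF assms] by simp
  have g: "g t = f s t * (s + of_real (\<beta> * exp (-t) - \<alpha> * exp t))" for t
    by (simp add: g_def f_def algebra_simps exp_add exp_diff exp_minus exp_of_real [symmetric] divide_inverse)
  have lim: "((\<lambda>t. exp (- \<alpha> * exp t - \<beta> * exp (- t) + Re s * t)) \<longlongrightarrow> 0) at_top"
     "((\<lambda>t. exp (- \<alpha> * exp t - \<beta> * exp (- t) + Re s * t)) \<longlongrightarrow> 0) at_bot"
    using assms by real_asymp+
  have "(LBINT t=-\<infinity>..\<infinity>. g t) = 0 - 0"
  proof (rule interval_integral_FTC_integrable[where F = "f s"])
    fix t :: real
    show "(f s has_vector_derivative g t) (at t)"
    proof -
      have "((\<lambda>z. exp (- \<alpha> * exp z - \<beta> * exp (- z) + s * z)) has_field_derivative g t) (at (of_real t))"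
        unfolding g f_def by (auto intro!: derivative_eq_intros simp: algebra_simps exp_of_real [symmetric])
      from has_vector_derivative_real_field[OF this] show ?thesis
        by (simp add: f_def exp_of_real [symmetric])
    qed
    show "isCont g t"
      unfolding g_def f_def by (intro continuous_intros)
  next
    show "set_integrable lborel (einterval (-\<infinity>) \<infinity>) g"
      unfolding g_def using int by (simp add: set_integrable_def)
    show "((f s \<circ> real_of_ereal) \<longlongrightarrow> 0) (at_right (-\<infinity>))"
      unfolding ereal_tendsto_simps1
      by (rule tendsto_norm_zero_cancel) (use lim(2) in \<open>simp add: f_def\<close>)
    show "((f s \<circ> real_of_ereal) \<longlongrightarrow> 0) (at_left \<infinity>)"
      unfolding ereal_tendsto_simps1
      by (rule tendsto_norm_zero_cancel) (use lim(1) in \<open>simp add: f_def\<close>)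
  qed auto
  then have "(LBINT t. g t) = 0"
    by (simp add: interval_lebesgue_integral_def set_lebesgue_integral_def)
  moreover have "(LBINT t. g t) = s * bessel_integral \<alpha> \<beta> s + \<beta> * bessel_integral \<alpha> \<beta> (s - 1) - \<alpha> * bessel_integral \<alpha> \<beta> (s + 1)"
  proof -
    have "bessel_integral \<alpha> \<beta> s = integral\<^sup>L lborel (f s)" for s by (simp only: bessel_integral_def f_def)
    then show ?thesis unfolding g_def using int by simp
  qed
  ultimately show ?thesis by simp
qed

text \<open>With u = \<beta> * exp (- t), replacing exp (- u) by 1 costs at most u, and the extra
  factor exp (- t) lowers the exponent by one. The error is thus a Gamma value at Re s - 1, smaller
  than the main term by a factor of order Re s when Im s is fixed.\<close>

lemma bessel_integral_minus_Gamma_bound: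
  assumes "\<alpha> > 0" "\<beta> > 0" "Re s > 1"
  shows "norm (bessel_integral \<alpha> \<beta> s - Gamma s * exp (- s * of_real (ln \<alpha>)))
     \<le> \<beta> * (Gamma (Re s - 1) * exp (- (Re s - 1) * ln \<alpha>))"
proof -
  define f where "f = (\<lambda>t. exp (of_real (- \<alpha> * exp t - \<beta> * exp (- t)) + s * complex_of_real t))"
  define g where "g = (\<lambda>s t. exp (of_real (- \<alpha> * exp t) + s * complex_of_real t))"
  have gi: "integrable lborel (g s)" "integrable lborel (g (s - 1))"
    and gv: "(LBINT t. g s t) = Gamma s * exp (- s * of_real (ln \<alpha>))"
    and gi': "integrable lborel (g (of_real (Re s - 1)))"
    and gv': "(LBINT t. g (of_real (Re s - 1)) t) = Gamma (of_real (Re s - 1)) * exp (- of_real (Re s - 1) * of_real (ln \<alpha>))"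
    unfolding g_def using assms
    by (intro integral_exp_gamma; simp)+
  have fi: "integrable lborel f" unfolding f_def by (rule integrable_bessel_integrand[OF assms(1,2)])
  have "norm (LBINT t. f t - g s t) \<le> (LBINT t. \<beta> * norm (g (of_real (Re s - 1)) t))"
  proof (rule Bochner_Integration.integral_norm_bound_integral)
    show "integrable lborel (\<lambda>t. f t - g s t)" using fi gi by simp
    show "integrable lborel (\<lambda>t. \<beta> * norm (g (of_real (Re s - 1)) t))" using gi' by simp
    fix t :: real
    define u where "u = \<beta> * exp (-t)"
    have u: "u > 0" using assms by (simp add: u_def)
    have "f t - g s t = g s t * of_real (exp (- u) - 1)"
      by (simp add: f_def g_def u_def algebra_simps exp_add exp_diff exp_of_real [symmetric] exp_minus divide_inverse)
    then have "norm (f t - g s t) = norm (g s t) * \<bar>exp (-u) - 1\<bar>"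
      by (simp only: norm_mult norm_of_real)
    also have "\<bar>exp (-u) - 1\<bar> \<le> u"
      using exp_ge_add_one_self[of "-u"] u by simp
    also have "norm (g s t) * u = \<beta> * norm (g (of_real (Re s - 1)) t)"
      by (simp add: g_def u_def exp_add [symmetric] mult.left_commute) (simp add: algebra_simps)
    finally show "norm (f t - g s t) \<le> \<beta> * norm (g (of_real (Re s - 1)) t)"
      by (simp add: mult_left_mono)
  qed
  also have "(LBINT t. f t - g s t) = bessel_integral \<alpha> \<beta> s - Gamma s * exp (- s * of_real (ln \<alpha>))"
    using fi gi gv by (simp add: bessel_integral_def f_def)
  also have "(LBINT t. \<beta> * norm (g (of_real (Re s - 1)) t)) = \<beta> * (Gamma (Re s - 1) * exp (- (Re s - 1) * ln \<alpha>))"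
  proof -
    \<comment> \<open>At a real exponent the integrand is its own norm, so the Gamma integral
      evaluates the bound exactly.\<close>
    have n: "complex_of_real (norm (g (of_real (Re s - 1)) t)) = g (of_real (Re s - 1)) t" for t
      by (simp add: g_def exp_of_real [symmetric])
    have "complex_of_real (LBINT t. norm (g (of_real (Re s - 1)) t)) = (LBINT t. g (of_real (Re s - 1)) t)"
      using integral_complex_of_real[of lborel "\<lambda>t. norm (g (of_real (Re s - 1)) t)"] by (simp only: n)
    also have "\<dots> = of_real (Gamma (Re s - 1) * exp (- (Re s - 1) * ln \<alpha>))"
      unfolding gv' by (simp only: Gamma_complex_of_real exp_of_real [symmetric] of_real_mult of_real_minus)
    finally have "(LBINT t. norm (g (of_real (Re s - 1)) t)) = Gamma (Re s - 1) * exp (- (Re s - 1) * ln \<alpha>)"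
      by (simp only: of_real_eq_iff)
    then show ?thesis by simp
  qed
  finally show ?thesis .
qed

text \<open>Expanding exp (s * t) and integrating termwise gives a power series in s that converges
  everywhere. The partial sums are dominated by w t * exp (|s| |t|), integrable because exp (r |t|)
  <= exp (r t) + exp (- r t).\<close>

lemma bessel_integral_holomorphic:
  assumes "\<alpha> > 0" "\<beta> > 0"
  shows "bessel_integral \<alpha> \<beta> holomorphic_on UNIV"
proof -
  define w where "w = (\<lambda>t. exp (- \<alpha> * exp t - \<beta> * exp (- t)))"
  have w0: "w t > 0" for t by (simp add: w_def)
  have wm [measurable]: "w \<in> borel_measurable lborel" unfolding w_def by measurable
  have wi: "integrable lborel (\<lambda>t. w t * exp (r * t))" for r
  proof -
    have "integrable lborel (\<lambda>t. norm (exp (of_real (- \<alpha> * exp t - \<beta> * exp (- t)) + complex_of_real r * of_real t)))"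
      using integrable_bessel_integrand[OF assms] by (rule integrable_norm)
    then show ?thesis by (simp add: w_def exp_add [symmetric])
  qed
  have wi2: "integrable lborel (\<lambda>t. w t * exp (r * \<bar>t\<bar>))" if "r \<ge> 0" for r
  proof (rule Bochner_Integration.integrable_bound)
    show "integrable lborel (\<lambda>t. w t * exp (r * t) + w t * exp (- r * t))"
      using wi[of r] wi[of "-r"] by simp
    show "AE t in lborel. norm (w t * exp (r * \<bar>t\<bar>)) \<le> norm (w t * exp (r * t) + w t * exp (- r * t))"
    proof (intro AE_I2)
      fix t
      have "exp (r * \<bar>t\<bar>) \<le> exp (r * t) + exp (- r * t)" by (auto simp: abs_if)
      then have "w t * exp (r * \<bar>t\<bar>) \<le> w t * exp (r * t) + w t * exp (- r * t)"
        using w0[of t] mult_left_mono[of _ _ "w t"] by (simp add: distrib_left [symmetric])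
      then show "norm (w t * exp (r * \<bar>t\<bar>)) \<le> norm (w t * exp (r * t) + w t * exp (- r * t))"
        using w0[of t] by simp
    qed
  qed measurable
  have sm: "(\<lambda>j. complex_of_real (LBINT t. w t * t ^ j / fact j) * s ^ j) sums bessel_integral \<alpha> \<beta> s" for s
  proof -
    define f where "f = (\<lambda>j t. complex_of_real (w t * t ^ j / fact j) * s ^ j)"
    have fn: "norm (f j t) = w t * ((norm s * \<bar>t\<bar>) ^ j / fact j)" for j t
      using w0[of t] by (simp add: f_def norm_mult norm_divide norm_power power_mult_distrib power_abs)
    have es: "(\<lambda>j. w t * ((norm s * \<bar>t\<bar>) ^ j / fact j)) sums (w t * exp (norm s * \<bar>t\<bar>))" for t
      using sums_mult[OF exp_converges[of "norm s * \<bar>t\<bar>"], of "w t"] by (simp add: divide_inverse mult.commute)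
    have part: "(\<Sum>j<N. norm (f j t)) \<le> w t * exp (norm s * \<bar>t\<bar>)" for N t
      unfolding fn using es[of t] w0[of t]
      using sum_le_suminf[of "\<lambda>j. w t * ((norm s * \<bar>t\<bar>) ^ j / fact j)" "{..<N}"]
      by (auto simp: sums_iff less_imp_le)
    have mf: "f j \<in> borel_measurable lborel" for j unfolding f_def by measurable
    have fi: "integrable lborel (f j)" for j
    proof (rule Bochner_Integration.integrable_bound)
      show "integrable lborel (\<lambda>t. w t * exp (norm s * \<bar>t\<bar>))" by (rule wi2) simp
      show "AE t in lborel. norm (f j t) \<le> norm (w t * exp (norm s * \<bar>t\<bar>))"
      proof (intro AE_I2)
        fix t
        have "norm (f j t) \<le> (\<Sum>j<Suc j. norm (f j t))" by (simp add: sum_nonneg)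
        also have "\<dots> \<le> w t * exp (norm s * \<bar>t\<bar>)" by (rule part)
        finally show "norm (f j t) \<le> norm (w t * exp (norm s * \<bar>t\<bar>))" by simp
      qed
    qed (rule mf)
    have "(\<lambda>j. integral\<^sup>L lborel (f j)) sums (LBINT t. \<Sum>j. f j t)"
    proof (rule sums_integral)
      show "integrable lborel (f j)" for j by (rule fi)
      show "AE t in lborel. summable (\<lambda>j. norm (f j t))"
        unfolding fn using es by (auto simp: sums_iff)
      show "summable (\<lambda>j. LBINT t. norm (f j t))"
      proof (rule summableI_nonneg_bounded)
        fix N
        have "(\<Sum>j<N. LBINT t. norm (f j t)) = (LBINT t. \<Sum>j<N. norm (f j t))"
          using fi by (subst Bochner_Integration.integral_sum) auto
        also have "\<dots> \<le> (LBINT t. w t * exp (norm s * \<bar>t\<bar>))"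
          using fi wi2[of "norm s"] part by (intro integral_mono) auto
        finally show "(\<Sum>j<N. LBINT t. norm (f j t)) \<le> (LBINT t. w t * exp (norm s * \<bar>t\<bar>))" .
      qed auto
    qed
    also have "(\<lambda>j. integral\<^sup>L lborel (f j)) = (\<lambda>j. complex_of_real (LBINT t. w t * t ^ j / fact j) * s ^ j)"
    proof
      fix j
      show "integral\<^sup>L lborel (f j) = complex_of_real (LBINT t. w t * t ^ j / fact j) * s ^ j"
        unfolding f_def by (subst integral_mult_left_zero) (simp only: integral_complex_of_real)
    qed
    also have "(LBINT t. \<Sum>j. f j t) = bessel_integral \<alpha> \<beta> s"
    proof -
      have "(\<Sum>j. f j t) = exp (of_real (- \<alpha> * exp t - \<beta> * exp (- t)) + s * of_real t)" for t
      proof -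
        have "(\<lambda>j. of_real (w t) * ((s * of_real t) ^ j /\<^sub>R fact j)) sums (of_real (w t) * exp (s * of_real t))"
          by (intro sums_mult exp_converges)
        also have "(\<lambda>j. of_real (w t) * ((s * of_real t) ^ j /\<^sub>R fact j)) = (\<lambda>j. f j t)"
          by (simp add: f_def fun_eq_iff power_mult_distrib scaleR_conv_of_real divide_inverse)
        also have "of_real (w t) * exp (s * of_real t) = exp (of_real (- \<alpha> * exp t - \<beta> * exp (- t)) + s * of_real t)"
          by (simp only: w_def exp_add exp_of_real)
        finally show ?thesis by (simp add: sums_iff)
      qed
      then show ?thesis by (simp add: bessel_integral_def)
    qed
    finally show ?thesis .
  qed
  have hol: "bessel_integral \<alpha> \<beta> holomorphic_on ball 0 r" for r
    by (rule power_series_holomorphic) (simp only: diff_zero, rule sm)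
  show ?thesis
    unfolding holomorphic_on_def
  proof
    fix z :: complex
    have "bessel_integral \<alpha> \<beta> field_differentiable at z"
      by (rule holomorphic_on_imp_differentiable_at[OF hol[of "norm z + 1"]]) auto
    then show "bessel_integral \<alpha> \<beta> field_differentiable at z within UNIV" by simp
  qed
qed

subsection \<open>The function 0F1\<close>

text \<open>The confluent hypergeometric limit function ${}_0F_1(;z;x)$. All estimates are restricted to
  $|\mathrm{Im}\, z| \ge 1$, where every factor of the Pochhammer symbol has modulus at least 1.\<close>

definition hyp01 :: "complex \<Rightarrow> complex \<Rightarrow> complex" where
  "hyp01 x z = (\<Sum>j. x ^ j / (fact j * pochhammer z j))"

lemma norm_ge_1_of_Im: "\<bar>Im z\<bar> \<ge> 1 \<Longrightarrow> norm z \<ge> 1"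
  using abs_Im_le_cmod[of z] by linarith

lemma norm_pochhammer_ge:
  assumes "\<bar>Im z\<bar> \<ge> 1"
  shows "norm (pochhammer z j) \<ge> 1" and "norm (pochhammer z (Suc j)) \<ge> norm z"
proof -
  have *: "norm (pochhammer z j) \<ge> 1" if "\<bar>Im z\<bar> \<ge> 1" for z j
  proof (induction j)
    case (Suc j)
    have "norm (z + of_nat j) \<ge> 1" using that by (intro norm_ge_1_of_Im) simp
    then show ?case using Suc mult_mono[of 1 "norm (pochhammer z j)" 1 "norm (z + of_nat j)"]
      by (simp add: pochhammer_Suc norm_mult)
  qed simp
  show "norm (pochhammer z j) \<ge> 1" using *[OF assms] .
  have "norm (pochhammer (z + 1) j) \<ge> 1" using * assms by simp
  then show "norm (pochhammer z (Suc j)) \<ge> norm z"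
    using mult_left_mono[of 1 "norm (pochhammer (z + 1) j)" "norm z"]
    by (simp add: pochhammer_rec norm_mult)
qed

lemma pochhammer_nonzero_of_Im: "\<bar>Im z\<bar> \<ge> 1 \<Longrightarrow> pochhammer z j \<noteq> 0"
  using norm_pochhammer_ge(1)[of z j] by auto

lemma norm_hyp01_term_le:
  assumes "\<bar>Im z\<bar> \<ge> 1"
  shows "norm (x ^ j / (fact j * pochhammer z j)) \<le> norm x ^ j / fact j"
proof -
  have "norm (x ^ j / (fact j * pochhammer z j)) = norm x ^ j / fact j / norm (pochhammer z j)"
    by (simp add: norm_divide norm_mult norm_power)
  also have "\<dots> \<le> norm x ^ j / fact j / 1"
    using norm_pochhammer_ge(1)[OF assms, of j] by (intro divide_left_mono) auto
  finally show ?thesis by simp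
qed

lemma summable_norm_exp_series: "summable (\<lambda>j. norm (x::complex) ^ j / fact j)"
  using summable_exp_generic[of "norm x"] by (simp add: divide_inverse mult.commute)

lemma summable_hyp01:
  assumes "\<bar>Im z\<bar> \<ge> 1"
  shows "summable (\<lambda>j. x ^ j / (fact j * pochhammer z j))"
  by (rule summable_comparison_test'[OF summable_norm_exp_series[of x]])
     (use norm_hyp01_term_le[OF assms] in auto)

lemma hyp01_sums:
  "\<bar>Im z\<bar> \<ge> 1 \<Longrightarrow> (\<lambda>j. x ^ j / (fact j * pochhammer z j)) sums hyp01 x z"
  unfolding hyp01_def using summable_hyp01 by (simp add: summable_sums)

text \<open>Every term with j >= 1 has z as a factor of its Pochhammer symbol, and the remaining
  factors have modulus at least 1.\<close>

lemma hyp01_bound: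
  assumes "\<bar>Im z\<bar> \<ge> 1"
  shows "norm (hyp01 x z - 1) \<le> exp (norm x) / norm z"
proof -
  have z: "norm z > 0" using norm_ge_1_of_Im[OF assms] by linarith
  define f where "f = (\<lambda>j. x ^ j / (fact j * pochhammer z j))"
  have s: "(\<lambda>j. f (Suc j)) sums (hyp01 x z - 1)"
    using hyp01_sums[OF assms, of x] unfolding f_def
    by (subst sums_Suc_iff) simp
  have le: "norm (f (Suc j)) \<le> norm x ^ Suc j / fact (Suc j) / norm z" for j
  proof -
    have "norm (f (Suc j)) = norm x ^ Suc j / fact (Suc j) / norm (pochhammer z (Suc j))"
      by (simp add: f_def norm_divide norm_mult norm_power del: power_Suc fact_Suc)
    also have "\<dots> \<le> norm x ^ Suc j / fact (Suc j) / norm z"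
      using norm_pochhammer_ge(2)[OF assms, of j] z by (intro divide_left_mono mult_pos_pos) auto
    finally show ?thesis .
  qed
  have sm0: "summable (\<lambda>j. norm x ^ Suc j / fact (Suc j))"
    using summable_ignore_initial_segment[OF summable_norm_exp_series[of x], of 1]
    unfolding Suc_eq_plus1 .
  then have sm: "summable (\<lambda>j. norm x ^ Suc j / fact (Suc j) / norm z)"
    by (rule summable_divide)
  have "norm (hyp01 x z - 1) \<le> (\<Sum>j. norm x ^ Suc j / fact (Suc j) / norm z)"
    unfolding sums_unique[OF s] by (rule norm_suminf_le[OF le sm])
  also have "\<dots> = (\<Sum>j. norm x ^ Suc j / fact (Suc j)) / norm z"
    using sm0 by (rule suminf_divide)
  also have "(\<Sum>j. norm x ^ Suc j / fact (Suc j)) = exp (norm x) - 1"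
    using suminf_split_head[OF summable_norm_exp_series[of x]]
    by (simp add: exp_def divide_inverse mult.commute)
  also have "(exp (norm x) - 1) / norm z \<le> exp (norm x) / norm z"
    by (intro divide_right_mono) auto
  finally show ?thesis .
qed

text \<open>A contiguous relation, proved on coefficients: the difference of the terms of index j +
  1 at z - 1 and at z is a multiple of the term of index j at z + 1. Multiplied by Gamma it becomes
  the Bessel recurrence.\<close>

lemma hyp01_rec:
  assumes "\<bar>Im z\<bar> \<ge> 1"
  shows "hyp01 x (z - 1) = hyp01 x z + x / (z * (z - 1)) * hyp01 x (z + 1)"
proof -
  have nz: "z + of_nat j \<noteq> 0" "z - 1 + of_nat j \<noteq> 0" for j :: nat
    using assms by (auto simp: complex_eq_iff)
  note nz0 = nz[of 0, simplified]
  define g where "g = (\<lambda>j. x ^ j / (fact j * pochhammer (z - 1) j) - x ^ j / (fact j * pochhammer z j))"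
  have "g sums (hyp01 x (z - 1) - hyp01 x z)"
    unfolding g_def using assms by (intro sums_diff hyp01_sums) auto
  then have "(\<lambda>j. g (Suc j)) sums (hyp01 x (z - 1) - hyp01 x z)"
    by (subst sums_Suc_iff) (simp add: g_def)
  moreover have "g (Suc j) = x / (z * (z - 1)) * (x ^ j / (fact j * pochhammer (z + 1) j))" for j
  proof -
    have p: "pochhammer z j \<noteq> 0" "pochhammer (z + 1) j \<noteq> 0"
      using assms by (auto intro!: pochhammer_nonzero_of_Im)
    have e1: "pochhammer (z - 1) (Suc j) = (z - 1) * pochhammer z j"
      by (simp add: pochhammer_rec)
    have e2: "pochhammer z j * (z + of_nat j) = z * pochhammer (z + 1) j"
      using pochhammer_rec[of z j] pochhammer_Suc[of z j] by simp
    have e3: "pochhammer z j = z * pochhammer (z + 1) j / (z + of_nat j)"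
      using e2 nz(1)[of j] by (simp add: field_simps)
    have "g (Suc j) = x ^ Suc j / fact (Suc j) * (1 / ((z - 1) * pochhammer z j) - 1 / (z * pochhammer (z + 1) j))"
      by (simp only: g_def e1 pochhammer_rec[of z j]) (simp add: right_diff_distrib)
    also have "1 / ((z - 1) * pochhammer z j) - 1 / (z * pochhammer (z + 1) j) =
        of_nat (Suc j) / (z * (z - 1) * pochhammer (z + 1) j)"
      unfolding e3 using nz0 nz(1)[of j] p by (simp add: divide_simps)
    also have "x ^ Suc j / fact (Suc j) * (of_nat (Suc j) / (z * (z - 1) * pochhammer (z + 1) j)) =
        x / (z * (z - 1)) * (x ^ j / (fact j * pochhammer (z + 1) j))"
      by (simp add: fact_Suc del: of_nat_Suc)
    finally show ?thesis .
  qed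
  ultimately have "(\<lambda>j. x / (z * (z - 1)) * (x ^ j / (fact j * pochhammer (z + 1) j))) sums (hyp01 x (z - 1) - hyp01 x z)"
    by simp
  moreover have "(\<lambda>j. x / (z * (z - 1)) * (x ^ j / (fact j * pochhammer (z + 1) j))) sums (x / (z * (z - 1)) * hyp01 x (z + 1))"
    using assms by (intro sums_mult hyp01_sums) auto
  ultimately show ?thesis using sums_unique2 by (metis add.commute diff_add_cancel)
qed

text \<open>The limit to the left holds as well, because the line of z stays at distance at least 1
  from the poles at the nonpositive integers.\<close>

lemma hyp01_tendsto:
  assumes "\<bar>Im z\<bar> \<ge> 1"
  shows "(\<lambda>N. hyp01 x (z + of_nat N)) \<longlonglongrightarrow> 1" and "(\<lambda>N. hyp01 x (z - of_nat N)) \<longlonglongrightarrow> 1"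
proof -
  have *: "(\<lambda>N. hyp01 x (f N)) \<longlonglongrightarrow> 1"
    if "\<And>N. \<bar>Im (f N)\<bar> \<ge> 1" "\<And>N::nat. norm (f N) \<ge> real N - norm z" for f
  proof -
    have "(\<lambda>N. exp (norm x) / (real N - norm z)) \<longlonglongrightarrow> 0"
      by real_asymp
    then have "(\<lambda>N. hyp01 x (f N) - 1) \<longlonglongrightarrow> 0"
    proof (rule Lim_null_comparison [rotated])
      show "\<forall>\<^sub>F N in sequentially. norm (hyp01 x (f N) - 1) \<le> exp (norm x) / (real N - norm z)"
      proof (rule eventually_sequentiallyI)
        fix N assume "nat \<lceil>norm z\<rceil> + 1 \<le> N"
        then have "real N - norm z > 0" by linarith
        then have "exp (norm x) / norm (f N) \<le> exp (norm x) / (real N - norm z)"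
          using that(2)[of N] by (intro divide_left_mono mult_pos_pos) auto
        then show "norm (hyp01 x (f N) - 1) \<le> exp (norm x) / (real N - norm z)"
          using hyp01_bound[OF that(1), of x N] by linarith
      qed
    qed
    then show ?thesis by (simp add: LIM_zero_iff)
  qed
  have n1: "norm (z + of_nat N) \<ge> real N - norm z" for N
    using norm_triangle_ineq2[of "of_nat N" "- z"] by (simp add: add.commute)
  have n2: "norm (z - of_nat N) \<ge> real N - norm z" for N
    using norm_triangle_ineq2[of "of_nat N" z] by (simp add: norm_minus_commute)
  show "(\<lambda>N. hyp01 x (z + of_nat N)) \<longlonglongrightarrow> 1"
    by (rule *[OF _ n1]) (use assms in simp)
  show "(\<lambda>N. hyp01 x (z - of_nat N)) \<longlonglongrightarrow> 1"
    by (rule *[OF _ n2]) (use assms in simp)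
qed

subsection \<open>The connection formula\<close>

text \<open>The value found in \<open>integral_exp_gamma\<close>, that is, the Bessel integral
  degenerated to \<beta> = 0.\<close>

definition scaled_Gamma :: "real \<Rightarrow> complex \<Rightarrow> complex" where
  "scaled_Gamma \<alpha> z = Gamma z * exp (- z * of_real (ln \<alpha>))"

text \<open>In classical terms pi / sin (pi s) * (\<beta>/\<alpha>)^(s/2) * I_{-s}(2
  sqrt(\<alpha>\<beta>)). The connection formula below is then 2 K_s = pi / sin (pi s) * (I_{-s} -
  I_s).\<close>

definition bessel_part :: "real \<Rightarrow> real \<Rightarrow> complex \<Rightarrow> complex" where
  "bessel_part \<alpha> \<beta> s = scaled_Gamma \<alpha> s * hyp01 (of_real (\<alpha> * \<beta>)) (1 - s)"

definition bessel_recurrence :: "real \<Rightarrow> real \<Rightarrow> (complex \<Rightarrow> complex) \<Rightarrow> bool" where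
  "bessel_recurrence \<alpha> \<beta> y \<longleftrightarrow> (\<forall>s. \<bar>Im s\<bar> \<ge> 1 \<longrightarrow> of_real \<alpha> * y (s + 1) = s * y s + of_real \<beta> * y (s - 1))"

definition casorati :: "(complex \<Rightarrow> complex) \<Rightarrow> (complex \<Rightarrow> complex) \<Rightarrow> complex \<Rightarrow> complex" where
  "casorati y z s = y (s + 1) * z s - y s * z (s + 1)"

lemma not_nonpos_Int_of_Im: "\<bar>Im z\<bar> \<ge> 1 \<Longrightarrow> z \<notin> \<int>\<^sub>\<le>\<^sub>0"
  by (auto elim!: nonpos_Ints_cases)

lemma Gamma_nonzero_of_Im: "\<bar>Im z\<bar> \<ge> 1 \<Longrightarrow> Gamma z \<noteq> 0"
  using not_nonpos_Int_of_Im[of z] by (simp add: Gamma_eq_zero_iff)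

lemma scaled_Gamma_plus1:
  assumes "\<alpha> > 0" "\<bar>Im z\<bar> \<ge> 1"
  shows "of_real \<alpha> * scaled_Gamma \<alpha> (z + 1) = z * scaled_Gamma \<alpha> z"
  using assms Gamma_plus1[OF not_nonpos_Int_of_Im[OF assms(2)]]
  by (simp add: scaled_Gamma_def algebra_simps exp_add exp_diff exp_minus exp_of_real divide_inverse)

text \<open>The functional equation of Gamma brings all three terms to a common factor; what remains
  is \<open>hyp01_rec\<close> at 1 - s.\<close>

lemma bessel_recurrence_bessel_part:
  assumes "\<alpha> > 0" "\<beta> > 0"
  shows "bessel_recurrence \<alpha> \<beta> (bessel_part \<alpha> \<beta>)"
  unfolding bessel_recurrence_def
proof (intro allI impI)
  fix s assume s: "\<bar>Im s\<bar> \<ge> 1"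
  define x where "x = complex_of_real (\<alpha> * \<beta>)"
  have nz: "s \<noteq> 0" "s - 1 \<noteq> 0" "1 - s \<noteq> 0" using s by (auto simp: complex_eq_iff)
  have e1: "of_real \<alpha> * scaled_Gamma \<alpha> (s + 1) = s * scaled_Gamma \<alpha> s" using assms s by (intro scaled_Gamma_plus1)
  have e2: "of_real \<alpha> * scaled_Gamma \<alpha> s = (s - 1) * scaled_Gamma \<alpha> (s - 1)" using scaled_Gamma_plus1[of \<alpha> "s - 1"] assms s by simp
  have h: "hyp01 x (- s) = hyp01 x (1 - s) + x / ((1 - s) * (- s)) * hyp01 x (2 - s)"
    using hyp01_rec[of "1 - s" x] s by simp
  have "of_real \<alpha> * bessel_part \<alpha> \<beta> (s + 1) = s * scaled_Gamma \<alpha> s * hyp01 x (- s)"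
    using e1 by (simp add: bessel_part_def x_def mult.assoc [symmetric])
  also have "\<dots> = s * bessel_part \<alpha> \<beta> s + scaled_Gamma \<alpha> s * x / (s - 1) * hyp01 x (2 - s)"
    unfolding h bessel_part_def x_def [symmetric] using nz by (simp add: field_simps)
  also have "scaled_Gamma \<alpha> s * x / (s - 1) = of_real \<beta> * scaled_Gamma \<alpha> (s - 1)"
  proof -
    have "scaled_Gamma \<alpha> s * x = (s - 1) * (of_real \<beta> * scaled_Gamma \<alpha> (s - 1))"
      using arg_cong[OF e2, of "(*) (of_real \<beta>)"] by (simp add: x_def mult_ac)
    then show ?thesis using nz by (simp add: field_simps)
  qed
  also have "of_real \<beta> * scaled_Gamma \<alpha> (s - 1) * hyp01 x (2 - s) = of_real \<beta> * bessel_part \<alpha> \<beta> (s - 1)"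
    by (simp add: bessel_part_def x_def)
  finally show "of_real \<alpha> * bessel_part \<alpha> \<beta> (s + 1) = s * bessel_part \<alpha> \<beta> s + of_real \<beta> * bessel_part \<alpha> \<beta> (s - 1)" .
qed

lemma bessel_recurrence_reflect:
  assumes "bessel_recurrence \<beta> \<alpha> y"
  shows "bessel_recurrence \<alpha> \<beta> (\<lambda>s. y (- s))"
  unfolding bessel_recurrence_def
proof (intro allI impI)
  fix s :: complex assume "\<bar>Im s\<bar> \<ge> 1"
  then have "of_real \<beta> * y (- s + 1) = - s * y (- s) + of_real \<alpha> * y (- s - 1)"
    using assms[unfolded bessel_recurrence_def, rule_format, of "- s"] by simp
  moreover have "- s + 1 = - (s - 1)" "- s - 1 = - (s + 1)" by simp_all
  ultimately have "of_real \<beta> * y (- (s - 1)) = - s * y (- s) + of_real \<alpha> * y (- (s + 1))"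
    by metis
  then show "of_real \<alpha> * y (- (s + 1)) = s * y (- s) + of_real \<beta> * y (- (s - 1))"
    by (metis add.commute add.left_cancel add_minus_cancel minus_mult_left)
qed

text \<open>The discrete form of Abel's identity: the middle coefficient cancels in the determinant,
  so each step only contributes the constant factor - \<beta>/\<alpha>.\<close>

lemma casorati_shift:
  assumes "bessel_recurrence \<alpha> \<beta> y" "bessel_recurrence \<alpha> \<beta> z" "\<alpha> > 0" "\<bar>Im s\<bar> \<ge> 1"
  shows "casorati y z (s + of_nat N) = (- of_real (\<beta> / \<alpha>)) ^ N * casorati y z s"
proof (induction N)
  case (Suc N)
  define w where "w = s + of_nat N"
  have "of_real \<alpha> * y (w + 1 + 1) = (w + 1) * y (w + 1) + of_real \<beta> * y (w + 1 - 1)"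
    "of_real \<alpha> * z (w + 1 + 1) = (w + 1) * z (w + 1) + of_real \<beta> * z (w + 1 - 1)"
    using assms(1,2)[unfolded bessel_recurrence_def, rule_format, of "w + 1"] assms(4) by (simp_all add: w_def)
  then have "of_real \<alpha> * casorati y z (w + 1) = - of_real \<beta> * casorati y z w"
    unfolding casorati_def by (simp add: algebra_simps) algebra
  then have "casorati y z (w + 1) = - of_real (\<beta> / \<alpha>) * casorati y z w"
    using assms by (simp add: field_simps)
  also have "w + 1 = s + of_nat (Suc N)" by (simp add: w_def)
  finally show ?case using Suc by (simp add: w_def)
qed simp

lemma sin_pi_plus_of_nat: "sin (of_real pi * (s + of_nat N)) = (-1) ^ N * sin (of_real pi * s :: complex)"
proof (induction N)
  case (Suc N)
  have "sin (of_real pi * (s + of_nat (Suc N))) = sin (of_real pi * (s + of_nat N) + of_real pi)"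
    by (simp add: algebra_simps)
  also have "\<dots> = - sin (of_real pi * (s + of_nat N))"
    by (simp only: sin_add sin_of_real cos_of_real) simp
  finally show ?case using Suc by simp
qed simp

text \<open>If the sine vanished, the reflection formula together with x / 0 = 0 would give Gamma s
  * Gamma (1 - s) = 0.\<close>

lemma sin_pi_nonzero_of_Im: "\<bar>Im s\<bar> \<ge> 1 \<Longrightarrow> sin (of_real pi * s) \<noteq> 0"
  by (metis Gamma_nonzero_of_Im[of s] Gamma_nonzero_of_Im[of "1 - s"] Gamma_reflection_complex[of s]
      abs_minus_cancel complex.sel(2) diff_0 div_by_0 minus_complex.sel(2) mult_eq_0_iff one_complex.sel(2))

lemma inverse_shift_tendsto_0: "(\<lambda>N. 1 / (s + of_nat N :: complex)) \<longlonglongrightarrow> 0"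
proof -
  have "filterlim (\<lambda>N. s + of_nat N) at_infinity sequentially"
    by (intro tendsto_add_filterlim_at_infinity[OF tendsto_const] tendsto_of_nat)
  then show ?thesis
    by (intro tendsto_divide_0[OF tendsto_const])
qed

text \<open>The Casorati determinant is known at $s$ as soon as it is known asymptotically at $s + N$;
  this reduces the connection formula below to first-order asymptotics.\<close>

lemma casorati_bessel_part:
  assumes "bessel_recurrence \<alpha> \<beta> y" "\<alpha> > 0" "\<beta> > 0" "\<bar>Im s\<bar> \<ge> 1"
    and lim: "(\<lambda>N. y (s + of_nat N) / scaled_Gamma \<alpha> (s + of_nat N)) \<longlonglongrightarrow> l"
  shows "casorati y (\<lambda>z. bessel_part \<beta> \<alpha> (- z)) s =
     - of_real pi / sin (of_real pi * s) * exp (s * of_real (ln \<beta> - ln \<alpha>)) / of_real \<alpha> * l"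
proof -
  define c where "c = - of_real pi / sin (of_real pi * s) * exp (s * of_real (ln \<beta> - ln \<alpha>)) / of_real \<alpha>"
  define q where "q = - complex_of_real (\<beta> / \<alpha>)"
  define x where "x = complex_of_real (\<beta> * \<alpha>)"
  define d where "d = (\<lambda>N. y (s + of_nat N) / scaled_Gamma \<alpha> (s + of_nat N))"
  have q0: "q \<noteq> 0" using assms by (simp add: q_def)
  have g0: "scaled_Gamma \<alpha> z \<noteq> 0" if "\<bar>Im z\<bar> \<ge> 1" for z
    using Gamma_nonzero_of_Im[OF that] by (simp add: scaled_Gamma_def)
  \<comment> \<open>The reflection formula turns the product of the two Gamma factors into an
    elementary expression. Its dependence on N is exactly the factor \<open>q ^ N\<close> of
    \<open>casorati_shift\<close>, up to 1 / (s + N).\<close>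
  have base: "scaled_Gamma \<alpha> (s + of_nat N) * scaled_Gamma \<beta> (- (s + of_nat N)) =
      q ^ N * c * of_real \<alpha> / (s + of_nat N)" (is "?L = _") for N
  proof -
    define z where "z = s + of_nat N"
    have "scaled_Gamma \<alpha> z * scaled_Gamma \<beta> (- z) = (Gamma z * Gamma (- z)) * exp (z * of_real (ln \<beta> - ln \<alpha>))"
      by (simp add: scaled_Gamma_def algebra_simps exp_add exp_diff exp_minus divide_inverse)
    also have "\<dots> = - of_real pi / (z * sin (of_real pi * z)) * exp (z * of_real (ln \<beta> - ln \<alpha>))"
      by (simp add: Gamma_reflection_complex')
    also have "sin (of_real pi * z) = (-1) ^ N * sin (of_real pi * s)"
      unfolding z_def by (rule sin_pi_plus_of_nat)
    also have "exp (z * of_real (ln \<beta> - ln \<alpha>)) = exp (s * of_real (ln \<beta> - ln \<alpha>)) * (of_real (\<beta> / \<alpha>)) ^ N"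
    proof -
      have "exp (complex_of_real (ln \<beta> - ln \<alpha>)) = of_real (\<beta> / \<alpha>)"
        using assms by (simp only: exp_of_real exp_diff exp_ln)
      then show ?thesis
        by (simp add: z_def distrib_right exp_add exp_of_nat_mult)
    qed
    also have "- of_real pi / (z * ((-1) ^ N * sin (of_real pi * s))) *
        (exp (s * of_real (ln \<beta> - ln \<alpha>)) * (of_real (\<beta> / \<alpha>)) ^ N) =
        ((-1) ^ N * of_real (\<beta> / \<alpha>) ^ N) * c * of_real \<alpha> / z"
    proof -
      have "1 / ((-1) ^ N :: complex) = (-1) ^ N" by (simp add: power_one_over [symmetric])
      then show ?thesis using assms
        by (simp add: c_def divide_simps)
    qed
    also have "(-1) ^ N * of_real (\<beta> / \<alpha>) ^ N = q ^ N"
      by (simp add: q_def power_mult_distrib [symmetric])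
    finally show ?thesis by (simp add: z_def)
  qed
  \<comment> \<open>After division by \<open>q ^ N\<close> the left side does not depend on N. On
    the right the first term has the limit c * l and the second is of order 1 / N^2.\<close>
  have val: "casorati y (\<lambda>z. bessel_part \<beta> \<alpha> (- z)) s =
      c * d (Suc N) * hyp01 x (1 + s + of_nat N) +
      c * of_real \<alpha> * of_real \<beta> * d N * hyp01 x (2 + s + of_nat N) * (1 / (s + of_nat N)) * (1 / (s + 1 + of_nat N))" for N
  proof -
    define z where "z = s + of_nat N"
    have z: "\<bar>Im z\<bar> \<ge> 1" "\<bar>Im (z + 1)\<bar> \<ge> 1" using assms by (simp_all add: z_def)
    have z0: "z \<noteq> 0" "z + 1 \<noteq> 0" using z by (auto simp: complex_eq_iff)
    have y1: "y z = d N * scaled_Gamma \<alpha> z" "y (z + 1) = d (Suc N) * scaled_Gamma \<alpha> (z + 1)"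
      using g0[OF z(1)] g0[OF z(2)] by (simp_all add: d_def z_def add_ac)
    have ga: "scaled_Gamma \<alpha> (z + 1) = z * scaled_Gamma \<alpha> z / of_real \<alpha>"
      using scaled_Gamma_plus1[OF assms(2) z(1)] assms by (simp add: field_simps)
    have gb: "scaled_Gamma \<beta> (- (z + 1)) = - of_real \<beta> * scaled_Gamma \<beta> (- z) / (z + 1)"
    proof -
      have "of_real \<beta> * scaled_Gamma \<beta> (- (z + 1) + 1) = - (z + 1) * scaled_Gamma \<beta> (- (z + 1))"
        using scaled_Gamma_plus1[OF assms(3), of "- (z + 1)"] z by simp
      moreover have "- (z + 1) + 1 = - z" by simp
      ultimately have "- of_real \<beta> * scaled_Gamma \<beta> (- z) = (z + 1) * scaled_Gamma \<beta> (- (z + 1))"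
        by (simp only:) (simp only: mult_minus_left minus_minus)
      then show ?thesis using z0(2) by (simp only: nonzero_mult_div_cancel_left not_False_eq_True)
    qed
    have a: "bessel_part \<beta> \<alpha> (- z) = scaled_Gamma \<beta> (- z) * hyp01 x (1 + z)"
      "bessel_part \<beta> \<alpha> (- (z + 1)) = - of_real \<beta> * scaled_Gamma \<beta> (- z) / (z + 1) * hyp01 x (2 + z)"
      unfolding bessel_part_def gb x_def [symmetric] by (simp_all add: add_ac)
    have "q ^ N * casorati y (\<lambda>z. bessel_part \<beta> \<alpha> (- z)) s = casorati y (\<lambda>z. bessel_part \<beta> \<alpha> (- z)) z"
      unfolding z_def q_def using assms
      by (subst casorati_shift[where \<alpha> = \<alpha> and \<beta> = \<beta>]) (auto intro!: bessel_recurrence_reflect bessel_recurrence_bessel_part)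
    also have "\<dots> = (scaled_Gamma \<alpha> z * scaled_Gamma \<beta> (- z)) * (d (Suc N) * z / of_real \<alpha> * hyp01 x (1 + z) +
         d N * of_real \<beta> / (z + 1) * hyp01 x (2 + z))"
      unfolding casorati_def y1 a ga by (simp add: algebra_simps)
    also have "\<dots> = q ^ N * (c * of_real \<alpha> / z * (d (Suc N) * z / of_real \<alpha> * hyp01 x (1 + z) +
         d N * of_real \<beta> / (z + 1) * hyp01 x (2 + z)))"
      using base[of N] by (simp add: z_def)
    finally have "casorati y (\<lambda>z. bessel_part \<beta> \<alpha> (- z)) s = c * of_real \<alpha> / z * (d (Suc N) * z / of_real \<alpha> * hyp01 x (1 + z) +
         d N * of_real \<beta> / (z + 1) * hyp01 x (2 + z))"
      using q0 by (metis mult_cancel_left power_not_zero)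
    also have "\<dots> = c * d (Suc N) * hyp01 x (1 + z) +
      c * of_real \<alpha> * of_real \<beta> * d N * hyp01 x (2 + z) * (1 / z) * (1 / (z + 1))"
      using z0 assms(2) by (simp add: distrib_left divide_inverse mult_ac)
    finally show ?thesis by (simp add: z_def add_ac)
  qed
  have "(\<lambda>N. c * d (Suc N) * hyp01 x (1 + s + of_nat N) +
      c * of_real \<alpha> * of_real \<beta> * d N * hyp01 x (2 + s + of_nat N) * (1 / (s + of_nat N)) * (1 / (s + 1 + of_nat N)))
      \<longlonglongrightarrow> c * l * 1 + c * of_real \<alpha> * of_real \<beta> * l * 1 * 0 * 0"
    using lim assms(4) unfolding d_def[symmetric]
    by (intro tendsto_intros hyp01_tendsto inverse_shift_tendsto_0 LIMSEQ_Suc) auto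
  \<comment> \<open>A constant sequence equals its limit.\<close>
  then have "casorati y (\<lambda>z. bessel_part \<beta> \<alpha> (- z)) s = c * l"
    unfolding val[symmetric] by (simp add: LIMSEQ_const_iff)
  then show ?thesis by (simp add: c_def)
qed

text \<open>Gauss's product limit, read as Gamma (z + N + 1) ~ N! N^z. It serves to compare |Gamma
  (s + N)| with Gamma (Re s + N).\<close>

lemma Gamma_shift_ratio_tendsto:
  fixes z :: "'a :: Gamma"
  assumes "z \<notin> \<int>\<^sub>\<le>\<^sub>0"
  shows "(\<lambda>N. Gamma (z + of_nat (Suc N)) / (fact N * exp (z * of_real (ln (real N))))) \<longlonglongrightarrow> 1"
proof -
  have G: "Gamma z \<noteq> 0" using assms by (simp add: Gamma_eq_zero_iff)
  have "(\<lambda>N. Gamma z / Gamma_series z N) \<longlonglongrightarrow> Gamma z / Gamma z"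
    by (intro tendsto_intros Gamma_series_LIMSEQ G)
  moreover have "Gamma z / Gamma_series z N = Gamma (z + of_nat (Suc N)) / (fact N * exp (z * of_real (ln (real N))))" for N
    using pochhammer_Gamma[OF assms, of "Suc N"] G by (simp add: Gamma_series_def del: of_nat_Suc)
  ultimately show ?thesis using G by simp
qed

text \<open>The error bound contains Gamma at a real point, the denominator Gamma at a complex one.
  Their ratio tends to 1 along s + N, and the argument lowered by one leaves a factor of order 1 /
  N.\<close>

lemma bessel_integral_over_scaled_Gamma_tendsto:
  assumes "\<alpha> > 0" "\<beta> > 0" "\<bar>Im s\<bar> \<ge> 1"
  shows "(\<lambda>N. bessel_integral \<alpha> \<beta> (s + of_nat N) / scaled_Gamma \<alpha> (s + of_nat N)) \<longlonglongrightarrow> 1"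
proof -
  have *: "(\<lambda>N. bessel_integral \<alpha> \<beta> (s + of_nat (Suc N)) / scaled_Gamma \<alpha> (s + of_nat (Suc N))) \<longlonglongrightarrow> 1"
    if s: "\<bar>Im s\<bar> \<ge> 1" "Re s > 0" for s
  proof -
    define \<sigma> where "\<sigma> = Re s"
    define r where "r = (\<lambda>N. norm (Gamma (s + of_nat (Suc N)) / (fact N * exp (s * of_real (ln (real N))))))"
    \<comment> \<open>Both \<open>r\<close> and \<open>r'\<close> are normalised by N! N^\<sigma> in
      modulus, so \<open>r' N / r N\<close> is the quotient of Gamma at the real part by |Gamma| at
      the point itself.\<close>
    define r' where "r' = (\<lambda>N. Gamma (\<sigma> + of_nat (Suc N)) / (fact N * exp (\<sigma> * ln (real N))))"
    have r: "r \<longlonglongrightarrow> norm (1::complex)"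
      unfolding r_def using s by (intro tendsto_norm Gamma_shift_ratio_tendsto not_nonpos_Int_of_Im)
    have r': "r' \<longlonglongrightarrow> 1"
    proof -
      have "\<sigma> \<notin> \<int>\<^sub>\<le>\<^sub>0" using s by (auto simp: \<sigma>_def elim!: nonpos_Ints_cases)
      from Gamma_shift_ratio_tendsto[OF this] show ?thesis by (simp add: r'_def)
    qed
    have i: "(\<lambda>N. \<alpha> * \<beta> / (\<sigma> + real N)) \<longlonglongrightarrow> 0" by real_asymp
    have "(\<lambda>N. \<alpha> * \<beta> / (\<sigma> + real N) * (r' N / r N)) \<longlonglongrightarrow> 0 * (1 / norm (1::complex))"
      by (intro tendsto_intros i r r') auto
    then have lim0: "(\<lambda>N. \<alpha> * \<beta> / (\<sigma> + real N) * (r' N / r N)) \<longlonglongrightarrow> 0" by simp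
    have "norm (bessel_integral \<alpha> \<beta> (s + of_nat (Suc N)) / scaled_Gamma \<alpha> (s + of_nat (Suc N)) - 1)
          \<le> \<alpha> * \<beta> / (\<sigma> + real N) * (r' N / r N)" for N
    proof -
      define z where "z = s + of_nat (Suc N)"
      have z: "\<bar>Im z\<bar> \<ge> 1" "Re z = \<sigma> + real N + 1" "\<sigma> > 0" using s by (auto simp: z_def \<sigma>_def)
      have gz: "scaled_Gamma \<alpha> z \<noteq> 0" using Gamma_nonzero_of_Im[OF z(1)] by (simp add: scaled_Gamma_def)
      have rr: "r' N / r N = Gamma (\<sigma> + real N + 1) / norm (Gamma z)"
        by (simp add: r_def r'_def z_def norm_divide norm_mult \<sigma>_def add_ac)
      have "norm (bessel_integral \<alpha> \<beta> z / scaled_Gamma \<alpha> z - 1) = norm (bessel_integral \<alpha> \<beta> z - scaled_Gamma \<alpha> z) / norm (scaled_Gamma \<alpha> z)"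
        using gz by (simp add: norm_divide [symmetric] diff_divide_distrib)
      also have "\<dots> \<le> \<beta> * (Gamma (Re z - 1) * exp (- (Re z - 1) * ln \<alpha>)) / norm (scaled_Gamma \<alpha> z)"
        unfolding scaled_Gamma_def using assms z by (intro divide_right_mono bessel_integral_minus_Gamma_bound) auto
      also have "norm (scaled_Gamma \<alpha> z) = norm (Gamma z) * exp (- Re z * ln \<alpha>)"
        by (simp add: scaled_Gamma_def norm_mult)
      also have "exp (- (Re z - 1) * ln \<alpha>) = exp (- Re z * ln \<alpha>) * \<alpha>"
        using assms by (simp add: algebra_simps exp_add exp_diff exp_minus divide_inverse)
      also have "Gamma (Re z - 1) = Gamma (\<sigma> + real N + 1) / (\<sigma> + real N)"
        using Gamma_plus1[of "\<sigma> + real N"] z by (subst Gamma_plus1) (auto elim!: nonpos_Ints_cases)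
      also have "\<beta> * (Gamma (\<sigma> + real N + 1) / (\<sigma> + real N) * (exp (- Re z * ln \<alpha>) * \<alpha>)) /
          (norm (Gamma z) * exp (- Re z * ln \<alpha>)) = \<alpha> * \<beta> / (\<sigma> + real N) * (r' N / r N)"
        unfolding rr using exp_not_eq_zero[of "- Re z * ln \<alpha>"] by (simp add: divide_inverse mult_ac)
      finally show ?thesis unfolding z_def .
    qed
    from Lim_null_comparison[OF always_eventually[OF allI[OF this]] lim0]
    have "(\<lambda>N. bessel_integral \<alpha> \<beta> (s + of_nat (Suc N)) / scaled_Gamma \<alpha> (s + of_nat (Suc N)) - 1) \<longlonglongrightarrow> 0" .
    then show ?thesis by (simp add: LIM_zero_iff)
  qed
  \<comment> \<open>A shift by M reaches the right half-plane; it does not change a limit along s +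
    N.\<close>
  obtain M :: nat where M: "- Re s < real M" using reals_Archimedean2 by blast
  have "(\<lambda>N. bessel_integral \<alpha> \<beta> (s + of_nat M + of_nat (Suc N)) / scaled_Gamma \<alpha> (s + of_nat M + of_nat (Suc N))) \<longlonglongrightarrow> 1"
    using assms M by (intro *) auto
  then have "(\<lambda>N. bessel_integral \<alpha> \<beta> (s + of_nat (N + Suc M)) / scaled_Gamma \<alpha> (s + of_nat (N + Suc M))) \<longlonglongrightarrow> 1"
    by (simp add: add_ac)
  then show ?thesis by (rule LIMSEQ_offset)
qed

text \<open>The defect \<open>D\<close> has vanishing Casorati determinant with both halves of the
  right-hand side. Since the determinant \<open>c\<close> of these two halves is nonzero,
  \<open>D\<close> must vanish.\<close>

theorem bessel_integral_eq_sum: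
  assumes "\<alpha> > 0" "\<beta> > 0" "\<bar>Im s\<bar> \<ge> 1"
  shows "bessel_integral \<alpha> \<beta> s = bessel_part \<alpha> \<beta> s + bessel_part \<beta> \<alpha> (- s)"
proof -
  define D where "D = (\<lambda>\<alpha> \<beta> s. bessel_integral \<alpha> \<beta> s - bessel_part \<alpha> \<beta> s - bessel_part \<beta> \<alpha> (- s))"
  define c where "c = (\<lambda>\<alpha> \<beta> s. - of_real pi / sin (of_real pi * s) * exp (s * of_real (ln \<beta> - ln \<alpha>)) / complex_of_real \<alpha>)"
  have cG: "casorati (bessel_part \<alpha> \<beta>) (\<lambda>z. bessel_part \<beta> \<alpha> (- z)) s = c \<alpha> \<beta> s"
    if "\<alpha> > 0" "\<beta> > 0" "\<bar>Im s\<bar> \<ge> 1" for \<alpha> \<beta> s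
  proof -
    have "bessel_part \<alpha> \<beta> (s + of_nat N) / scaled_Gamma \<alpha> (s + of_nat N) = hyp01 (of_real (\<alpha> * \<beta>)) (1 - s - of_nat N)" for N
      using Gamma_nonzero_of_Im[of "s + of_nat N"] that by (simp add: bessel_part_def scaled_Gamma_def algebra_simps)
    then have "(\<lambda>N. bessel_part \<alpha> \<beta> (s + of_nat N) / scaled_Gamma \<alpha> (s + of_nat N)) \<longlonglongrightarrow> 1"
      using hyp01_tendsto(2)[of "1 - s"] that by simp
    from casorati_bessel_part[OF bessel_recurrence_bessel_part _ _ _ this] show ?thesis using that by (simp add: c_def)
  qed
  have cD: "casorati (D \<alpha> \<beta>) (\<lambda>z. bessel_part \<beta> \<alpha> (- z)) s = 0"
    if "\<alpha> > 0" "\<beta> > 0" "\<bar>Im s\<bar> \<ge> 1" for \<alpha> \<beta> s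
  proof -
    have "bessel_recurrence \<alpha> \<beta> (bessel_integral \<alpha> \<beta>)" using bessel_integral_recurrence that by (simp add: bessel_recurrence_def)
    from casorati_bessel_part[OF this _ _ _ bessel_integral_over_scaled_Gamma_tendsto]
    have "casorati (bessel_integral \<alpha> \<beta>) (\<lambda>z. bessel_part \<beta> \<alpha> (- z)) s = c \<alpha> \<beta> s"
      using that by (simp add: c_def)
    with cG[OF that] show ?thesis by (simp add: casorati_def D_def algebra_simps)
  qed
  have sw: "D \<beta> \<alpha> (- z) = D \<alpha> \<beta> z" for z
    by (simp add: D_def bessel_integral_swap[of \<beta> \<alpha>])
  have 1: "D \<alpha> \<beta> (s + 1) * bessel_part \<beta> \<alpha> (- s) = D \<alpha> \<beta> s * bessel_part \<beta> \<alpha> (- (s + 1))"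
    using cD[OF assms] by (simp add: casorati_def)
  \<comment> \<open>The same vanishing with \<alpha> and \<beta> exchanged, at - (s + 1): by the
    symmetry \<open>sw\<close> this is the determinant of \<open>D\<close> with the other half,
    obtained from the behaviour at the opposite end.\<close>
  have 2: "D \<alpha> \<beta> s * bessel_part \<alpha> \<beta> (s + 1) = D \<alpha> \<beta> (s + 1) * bessel_part \<alpha> \<beta> s"
    using cD[OF assms(2,1), of "- (s + 1)"] assms(3) sw[of s] sw[of "s + 1"] by (simp add: casorati_def add.commute)
  have "c \<alpha> \<beta> s \<noteq> 0" using assms sin_pi_nonzero_of_Im[OF assms(3)] by (simp add: c_def)
  moreover have "D \<alpha> \<beta> s * c \<alpha> \<beta> s = 0"
    unfolding cG[OF assms, symmetric] casorati_def
    using 1 2 by algebra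
  ultimately have "D \<alpha> \<beta> s = 0" by simp
  then show ?thesis by (simp add: D_def diff_eq_eq add.commute)
qed

subsection \<open>Exponential sums\<close>

lemma finite_common_convergent_subseq:
  fixes x :: "'i \<Rightarrow> nat \<Rightarrow> 'b::heine_borel"
  assumes "finite I" "\<And>i. i \<in> I \<Longrightarrow> bounded (range (x i))"
  shows "\<exists>r. strict_mono (r :: nat \<Rightarrow> nat) \<and> (\<forall>i\<in>I. convergent (x i \<circ> r))"
  using assms
proof (induction I rule: finite_induct)
  case empty
  show ?case by (intro exI[of _ id]) (auto simp: strict_mono_def)
next
  case (insert i I)
  then obtain r where r: "strict_mono r" "\<forall>i\<in>I. convergent (x i \<circ> r)" by blast
  have "bounded (range (x i \<circ> r))"
    using insert.prems[OF insertI1] by (rule bounded_subset) auto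
  then obtain l r' where r': "strict_mono r'" "((x i \<circ> r) \<circ> r') \<longlonglongrightarrow> l"
    using bounded_imp_convergent_subsequence by blast
  have "convergent (x k \<circ> (r \<circ> r'))" if "k \<in> insert i I" for k
  proof (cases "k = i")
    case True
    then show ?thesis using r'(2) by (auto simp: convergent_def o_assoc)
  next
    case False
    then have "convergent ((x k \<circ> r) \<circ> r')"
      using that r(2) r'(1) by (meson convergent_subseq_convergent insertE)
    then show ?thesis by (simp add: o_assoc)
  qed
  then show ?case using strict_mono_o[OF r(1) r'(1)] by blast
qed

text \<open>Hurwitz' theorem asks for a nonconstant limit function. A sum constant on an open set is
  constant everywhere, and letting z tend to minus infinity isolates the largest frequency with a
  nonzero coefficient. All frequencies are positive, so the constant cannot compensate that
  term.\<close>

lemma expsum_not_constant: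
  fixes l :: "nat \<Rightarrow> real" and c :: "nat \<Rightarrow> complex"
  assumes l: "strict_mono l" "l 0 > 0" and c: "\<exists>m\<le>n. c m \<noteq> 0" and S: "open S" "S \<noteq> {}"
  shows "\<not> (\<lambda>z. \<Sum>m\<le>n. c m * exp (- z * of_real (l m))) constant_on S"
proof
  define f where "f = (\<lambda>z. \<Sum>m\<le>n. c m * exp (- z * of_real (l m)))"
  assume "(\<lambda>z. \<Sum>m\<le>n. c m * exp (- z * of_real (l m))) constant_on S"
  then obtain C where C: "\<And>z. z \<in> S \<Longrightarrow> f z = C" by (auto simp: constant_on_def f_def)
  have fC: "f z = C" for z
  proof (rule analytic_continuation_open[of S UNIV f "\<lambda>_. C"])
    show "f holomorphic_on UNIV" unfolding f_def by (intro holomorphic_intros)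
  qed (use S C in \<open>auto intro: holomorphic_intros\<close>)
  define M where "M = Max {m. m \<le> n \<and> c m \<noteq> 0}"
  have M: "M \<in> {m. m \<le> n \<and> c m \<noteq> 0}" unfolding M_def using c by (intro Max_in) auto
  have Mmax: "c m = 0" if "m \<le> n" "m > M" for m
  proof (rule ccontr)
    assume "c m \<noteq> 0"
    then have "m \<le> M" unfolding M_def using that by (intro Max_ge) auto
    then show False using that by simp
  qed
  have "((\<lambda>x. \<Sum>m\<le>n. c m * of_real (exp (x * (l m - l M)))) \<longlongrightarrow> (\<Sum>m\<le>n. if m = M then c M else 0)) at_top"
  proof (rule tendsto_sum)
    fix m assume m: "m \<in> {..n}"
    consider "m < M" | "m = M" | "m > M" by linarith
    then show "((\<lambda>x. c m * of_real (exp (x * (l m - l M)))) \<longlongrightarrow> (if m = M then c M else 0)) at_top"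
    proof cases
      case 1
      then have "l m - l M < 0" using l by (simp add: strict_mono_less)
      then have "((\<lambda>x. exp (x * (l m - l M))) \<longlongrightarrow> 0) at_top" by real_asymp
      from tendsto_mult[OF tendsto_const[of "c m"] tendsto_of_real[OF this]] show ?thesis using 1 by simp
    qed (use m Mmax in auto)
  qed
  moreover have "(\<Sum>m\<le>n. c m * of_real (exp (x * (l m - l M)))) = C * of_real (exp (- x * l M))" for x
  proof -
    have "C * of_real (exp (- x * l M)) = f (- of_real x) * of_real (exp (- x * l M))"
      by (simp add: fC)
    also have "\<dots> = (\<Sum>m\<le>n. c m * (exp (of_real (x * l m)) * exp (of_real (- x * l M))))"
      by (simp add: f_def sum_distrib_right exp_of_real [symmetric] mult.assoc)
    also have "\<dots> = (\<Sum>m\<le>n. c m * of_real (exp (x * (l m - l M))))"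
      by (intro sum.cong refl) (simp add: exp_of_real [symmetric] exp_add [symmetric] algebra_simps)
    finally show ?thesis by simp
  qed
  ultimately have "((\<lambda>x. C * of_real (exp (- x * l M))) \<longlongrightarrow> c M) at_top"
    using M by simp
  moreover have "((\<lambda>x. C * of_real (exp (- x * l M))) \<longlongrightarrow> C * of_real 0) at_top"
  proof (intro tendsto_intros)
    have "l M > 0" using l strict_mono_leD[OF l(1), of 0 M] by linarith
    then show "((\<lambda>x. exp (- x * l M)) \<longlongrightarrow> 0) at_top" by real_asymp
  qed
  ultimately have "c M = C * of_real 0" by (rule tendsto_unique[rotated]) simp
  then show False using M by simp
qed

lemma uniform_limit_sum:
  fixes f :: "'i \<Rightarrow> 'a \<Rightarrow> 'b \<Rightarrow> 'c :: real_normed_vector"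
  assumes "finite I" "\<And>i. i \<in> I \<Longrightarrow> uniform_limit X (f i) (g i) F"
  shows "uniform_limit X (\<lambda>n x. \<Sum>i\<in>I. f i n x) (\<lambda>x. \<Sum>i\<in>I. g i x) F"
  using assms
  by (induction I rule: finite_induct) (auto intro!: uniform_limit_add uniform_limit_const)

text \<open>Vertical translates of an exponential sum have limits of the same shape, to which
  Hurwitz' theorem applies.\<close>

lemma expsum_bounded_below:
  fixes l :: "nat \<Rightarrow> real" and c :: "nat \<Rightarrow> complex" and f :: "complex \<Rightarrow> complex"
    and n :: nat
  defines "f \<equiv> (\<lambda>z. \<Sum>m\<le>n. c m * exp (- z * of_real (l m)))"
  assumes l: "strict_mono l" "l 0 > 0" and c: "\<exists>m\<le>n. c m \<noteq> 0"
    and nz: "\<And>z. u < Re z \<Longrightarrow> Re z < v \<Longrightarrow> f z \<noteq> 0"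
    and uv: "u < u'" "v' < v"
  shows "\<exists>e>0. \<forall>z. u' \<le> Re z \<longrightarrow> Re z \<le> v' \<longrightarrow> norm (f z) \<ge> e"
proof (rule ccontr)
  assume contra: "\<not> ?thesis"
  have "\<exists>z. u' \<le> Re z \<and> Re z \<le> v' \<and> norm (f z) < 1 / real (Suc j)" for j
  proof -
    have "1 / real (Suc j) > 0" by simp
    with contra show ?thesis by (meson not_le)
  qed
  then obtain s where s: "\<And>j. u' \<le> Re (s j)" "\<And>j. Re (s j) \<le> v'" "\<And>j. norm (f (s j)) < 1 / real (Suc j)"
    by metis
  define w where "w = (\<lambda>m j. exp (- \<i> * of_real (Im (s j) * l m)))"
  \<comment> \<open>The n + 1 sequences of phases and, at index Suc n, the sequence of real parts
    form one finite family, so that a single extraction makes all of them converge.\<close>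
  define x where "x = (\<lambda>m. if m \<le> n then w m else (\<lambda>j. complex_of_real (Re (s j))))"
  have nw: "norm (w m j) = 1" for m j by (simp add: w_def norm_exp_eq_Re)
  have "\<exists>r. strict_mono (r :: nat \<Rightarrow> nat) \<and> (\<forall>m\<in>{..Suc n}. convergent (x m \<circ> r))"
  proof (rule finite_common_convergent_subseq)
    fix m
    show "bounded (range (x m))"
    proof -
      have "norm (x m j) \<le> 1 + \<bar>u'\<bar> + \<bar>v'\<bar>" for j
      proof -
        have "\<bar>Re (s j)\<bar> \<le> 1 + \<bar>u'\<bar> + \<bar>v'\<bar>" using s(1,2)[of j] by linarith
        then show ?thesis by (simp add: x_def nw)
      qed
      then show ?thesis unfolding bounded_iff by blast
    qed
  qed simp
  then obtain r where r: "strict_mono r" "\<And>m. m \<le> Suc n \<Longrightarrow> convergent (x m \<circ> r)" by auto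
  have "\<exists>\<omega>. \<forall>m\<le>n. (\<lambda>j. w m (r j)) \<longlonglongrightarrow> \<omega> m"
  proof -
    have "\<forall>m. \<exists>L. m \<le> n \<longrightarrow> (\<lambda>j. w m (r j)) \<longlonglongrightarrow> L"
    proof
      fix m
      show "\<exists>L. m \<le> n \<longrightarrow> (\<lambda>j. w m (r j)) \<longlonglongrightarrow> L"
        using r(2)[of m] by (cases "m \<le> n") (auto simp: x_def convergent_def o_def)
    qed
    then show ?thesis by (rule choice)
  qed
  then obtain \<omega> where \<omega>: "\<And>m. m \<le> n \<Longrightarrow> (\<lambda>j. w m (r j)) \<longlonglongrightarrow> \<omega> m" by auto
  obtain \<rho>0 where \<rho>0: "(\<lambda>j. complex_of_real (Re (s (r j)))) \<longlonglongrightarrow> \<rho>0"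
    using r(2)[of "Suc n"] by (auto simp: x_def convergent_def o_def)
  define \<rho> where "\<rho> = Re \<rho>0"
  have \<rho>: "(\<lambda>j. Re (s (r j))) \<longlonglongrightarrow> \<rho>" using tendsto_Re[OF \<rho>0] by (simp add: \<rho>_def)
  have \<rho>uv: "u' \<le> \<rho>" "\<rho> \<le> v'"
    using \<rho> s(1,2) by (auto intro: LIMSEQ_le_const LIMSEQ_le_const2)
  \<comment> \<open>Limits of unimodular phases are unimodular, so no coefficient is lost and
    \<open>g\<close> is again a nontrivial exponential sum.\<close>
  have n\<omega>: "\<omega> m \<noteq> 0" if "m \<le> n" for m
  proof -
    have "(\<lambda>j. norm (w m (r j))) \<longlonglongrightarrow> norm (\<omega> m)" using \<omega>[OF that] by (rule tendsto_norm)
    then have "norm (\<omega> m) = 1" unfolding nw by (simp add: LIMSEQ_const_iff)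
    then show ?thesis by auto
  qed
  define S where "S = {z. u < Re z \<and> Re z < v}"
  define F where "F = (\<lambda>j z. \<Sum>m\<le>n. (c m * w m (r j)) * exp (- z * of_real (l m)))"
  define g where "g = (\<lambda>z. \<Sum>m\<le>n. (c m * \<omega> m) * exp (- z * of_real (l m)))"
  \<comment> \<open>\<open>F j\<close> is a vertical translate of \<open>f\<close>, hence free of
    zeros on the whole strip. Hurwitz passes this on to \<open>g\<close>, whereas the choice of
    \<open>s\<close> forces \<open>g\<close> to vanish at \<rho>.\<close>
  have F: "F j z = f (z + \<i> * of_real (Im (s (r j))))" for j z
    unfolding F_def f_def w_def
    by (intro sum.cong refl) (simp add: algebra_simps exp_add exp_diff exp_minus divide_inverse)
  have Seq: "S = {z. Re z > u} \<inter> {z. Re z < v}" by (auto simp: S_def)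
  have "g (of_real \<rho>) \<noteq> 0"
  proof (rule Hurwitz_no_zeros[of S F g])
    show "open S" unfolding Seq by (intro open_Int open_halfspace_Re_gt open_halfspace_Re_lt)
    show "connected S" unfolding Seq
      by (intro convex_connected convex_Int convex_halfspace_Re_gt convex_halfspace_Re_lt)
    show "F j holomorphic_on S" for j unfolding F_def by (intro holomorphic_intros)
    show "g holomorphic_on S" unfolding g_def by (intro holomorphic_intros)
    show "of_real \<rho> \<in> S" using \<rho>uv uv by (simp add: S_def)
    then have "S \<noteq> {}" by auto
    then show "\<not> g constant_on S"
      unfolding g_def using l c n\<omega> \<open>open S\<close> by (intro expsum_not_constant) auto
    show "F j z \<noteq> 0" if "z \<in> S" for j z
      unfolding F using that by (intro nz) (auto simp: S_def)
    show "uniform_limit K F g sequentially" if K: "compact K" "K \<subseteq> S" for K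
      unfolding F_def g_def
    proof (rule uniform_limit_sum)
      fix m assume m: "m \<in> {..n}"
      have u1: "uniform_limit K (\<lambda>j z. c m * w m (r j)) (\<lambda>z. c m * \<omega> m) sequentially"
      proof (rule uniform_limitI)
        fix e :: real assume "e > 0"
        have "(\<lambda>j. c m * w m (r j)) \<longlonglongrightarrow> c m * \<omega> m" using \<omega> m by (intro tendsto_intros) auto
        then show "\<forall>\<^sub>F j in sequentially. \<forall>z\<in>K. dist (c m * w m (r j)) (c m * \<omega> m) < e"
          using \<open>e > 0\<close> by (auto simp: tendsto_iff)
      qed
      have b1: "bounded ((\<lambda>z. exp (- z * of_real (l m))) ` K)"
        using K by (intro compact_imp_bounded compact_continuous_image continuous_intros)
      show "uniform_limit K (\<lambda>j z. c m * w m (r j) * exp (- z * of_real (l m)))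
           (\<lambda>z. c m * \<omega> m * exp (- z * of_real (l m))) sequentially"
        by (rule uniform_lim_mult[OF u1 uniform_limit_const _ b1]) (auto simp: bounded_iff)
    qed simp
  qed
  moreover have "(\<lambda>j. F j (of_real (Re (s (r j))))) \<longlonglongrightarrow> g (of_real \<rho>)"
    unfolding F_def g_def using \<omega> \<rho> by (intro tendsto_intros) auto
  moreover have "(\<lambda>j. F j (of_real (Re (s (r j))))) \<longlonglongrightarrow> 0"
  proof -
    have eq: "F j (of_real (Re (s (r j)))) = f (s (r j))" for j
      unfolding F by (simp add: complex_eq [symmetric])
    have "(\<lambda>j. f (s j)) \<longlonglongrightarrow> 0"
      by (rule Lim_null_comparison[OF always_eventually LIMSEQ_inverse_real_of_nat])
         (use s(3) in \<open>auto simp: inverse_eq_divide intro: less_imp_le\<close>)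
    from LIMSEQ_subseq_LIMSEQ[OF this r(1)] show ?thesis by (simp add: eq o_def)
  qed
  ultimately show False using LIMSEQ_unique by blast
qed

subsection \<open>Growth of the digamma function on vertical lines\<close>

text \<open>Termwise comparison of the limit formula for Digamma at z with that at 1. No term of the
  sum at z exceeds its counterpart, because Re z >= 1; the first M are at most half of it once Im z
  is large, which gains half a harmonic sum.\<close>

lemma Re_Digamma_ge:
  assumes "1 \<le> Re z" "Re z \<le> X" "(Im z)\<^sup>2 \<ge> 2 * (X + real M) * (1 + real M)"
  shows "Re (Digamma z) \<ge> Digamma 1 + (\<Sum>n<M. 1 / (2 * (1 + real n)))"
proof -
  have z0: "z \<noteq> 0" using assms by auto
  have l1: "(\<lambda>m. Re (of_real (ln (real m)) - (\<Sum>n<m. inverse (z + of_nat n)))) \<longlonglongrightarrow> Re (Digamma z)"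
    by (intro tendsto_Re Digamma_LIMSEQ z0)
  have l2: "(\<lambda>m. ln (real m) - (\<Sum>n<m. inverse (1 + real n))) \<longlonglongrightarrow> Digamma 1"
    using Digamma_LIMSEQ[of "1::real"] by simp
  have term1: "Re (inverse (z + of_nat n)) \<le> inverse (1 + real n)" for n
  proof -
    define x where "x = Re z + real n"
    have x: "x \<ge> 1 + real n" "x > 0" using assms by (auto simp: x_def)
    have "Re (inverse (z + of_nat n)) = x / (x\<^sup>2 + (Im z)\<^sup>2)" by (simp add: x_def)
    also have "\<dots> \<le> x / x\<^sup>2" using x by (intro divide_left_mono mult_pos_pos add_pos_nonneg) auto
    also have "\<dots> = inverse x" using x by (simp add: power2_eq_square field_simps)
    also have "\<dots> \<le> inverse (1 + real n)" using x by (intro le_imp_inverse_le) auto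
    finally show ?thesis .
  qed
  have term2: "Re (inverse (z + of_nat n)) \<le> inverse (1 + real n) - 1 / (2 * (1 + real n))" if "n < M" for n
  proof -
    define x where "x = Re z + real n"
    have x: "x > 0" "x \<le> X + real M" using assms that by (auto simp: x_def)
    have y: "(Im z)\<^sup>2 > 0" 
      using assms(3) x mult_pos_pos[of "X + real M" "1 + real M"] by linarith
    have "Re (inverse (z + of_nat n)) = x / (x\<^sup>2 + (Im z)\<^sup>2)" by (simp add: x_def)
    also have "\<dots> \<le> x / (Im z)\<^sup>2" using x y by (intro divide_left_mono mult_pos_pos add_nonneg_pos) auto
    also have "\<dots> \<le> 1 / (2 * (1 + real n))"
    proof -
      have "2 * x * (1 + real n) \<le> 2 * (X + real M) * (1 + real M)"
        using x that by (intro mult_mono) auto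
      then show ?thesis using assms(3) y by (simp add: field_simps)
    qed
    also have "\<dots> = inverse (1 + real n) - 1 / (2 * (1 + real n))" by (simp add: field_simps)
    finally show ?thesis .
  qed
  have "Digamma 1 + (\<Sum>n<M. 1 / (2 * (1 + real n))) \<le> Re (Digamma z)"
  proof (rule LIMSEQ_le[OF tendsto_add[OF l2 tendsto_const] l1])
    show "\<exists>N. \<forall>m\<ge>N. ln (real m) - (\<Sum>n<m. inverse (1 + real n)) + (\<Sum>n<M. 1 / (2 * (1 + real n)))
       \<le> Re (of_real (ln (real m)) - (\<Sum>n<m. inverse (z + of_nat n)))"
    proof (intro exI allI impI)
      fix m assume m: "M \<le> m"
      have "(\<Sum>n<m. Re (inverse (z + of_nat n))) \<le>
         (\<Sum>n<m. inverse (1 + real n) - (if n < M then 1 / (2 * (1 + real n)) else 0))"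
        using term1 term2 by (intro sum_mono) (simp del: inverse_complex.simps)
      also have "\<dots> = (\<Sum>n<m. inverse (1 + real n)) - (\<Sum>n<m. if n < M then 1 / (2 * (1 + real n)) else 0)"
        by (simp add: sum_subtractf)
      also have "(\<Sum>n<m. if n < M then 1 / (2 * (1 + real n)) else 0) = (\<Sum>n<M. 1 / (2 * (1 + real n)))"
        using m by (intro sum.mono_neutral_cong_right) auto
      finally show "ln (real m) - (\<Sum>n<m. inverse (1 + real n)) + (\<Sum>n<M. 1 / (2 * (1 + real n)))
         \<le> Re (of_real (ln (real m)) - (\<Sum>n<m. inverse (z + of_nat n)))"
        by (simp del: inverse_complex.simps)
    qed
  qed
  then show ?thesis .
qed

text \<open>The harmonic gain of \<open>Re_Digamma_ge\<close> is unbounded. Its hypothesis Re z >= 1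
  is reached by a shift by N, which changes Digamma by at most N because each 1 / (z + i) has norm
  at most 1.\<close>

lemma Re_Digamma_large:
  "\<exists>T\<ge>1. \<forall>z. \<bar>Re z\<bar> \<le> A \<longrightarrow> \<bar>Im z\<bar> \<ge> T \<longrightarrow> Re (Digamma z) \<ge> B"
proof -
  obtain N :: nat where N: "A + 1 \<le> real N" using real_arch_simple by blast
  define X where "X = \<bar>A\<bar> + real N"
  have "filterlim (\<lambda>M. harm M :: real) at_top sequentially" by (rule harm_at_top)
  then have "\<forall>\<^sub>F M in sequentially. harm M \<ge> 2 * (B + real N - Digamma 1)"
    unfolding filterlim_at_top by blast
  \<comment> \<open>The gain is \<open>harm M / 2\<close>; it has to exceed B by the cost N of the
    shift and by the value at 1.\<close>
  then obtain M where M: "harm M \<ge> 2 * (B + real N - Digamma 1)"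
    unfolding eventually_sequentially by blast
  have hs: "(\<Sum>n<M. 1 / (2 * (1 + real n))) = harm M / 2"
  proof -
    have "harm M = (\<Sum>n<M. inverse (1 + real n))"
      unfolding harm_def by (induction M) (simp_all add: add.commute)
    then show ?thesis by (simp add: sum_divide_distrib inverse_eq_divide algebra_simps)
  qed
  \<comment> \<open>The summand 1 gives T >= 1, so that |Im z| >= T implies (Im z)^2 >= T.\<close>
  define T where "T = 1 + 2 * (X + real M) * (1 + real M)"
  have X0: "X \<ge> 0" by (simp add: X_def)
  have T1: "T \<ge> 1" using X0 by (simp add: T_def)
  have "Re (Digamma z) \<ge> B" if z: "\<bar>Re z\<bar> \<le> A" "\<bar>Im z\<bar> \<ge> T" for z
  proof -
    have shift: "Digamma (z + of_nat N) = Digamma z + (\<Sum>i<N. 1 / (z + of_nat i))" for N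
    proof (induction N)
      case (Suc N)
      have "z + of_nat N \<noteq> 0" using z T1 by (auto simp: complex_eq_iff)
      from Digamma_plus1[OF this] show ?case using Suc by (simp add: add_ac)
    qed simp
    have "T \<le> \<bar>Im z\<bar> * \<bar>Im z\<bar>"
      using mult_mono[OF z(2), of 1 "\<bar>Im z\<bar>"] z T1 by simp
    then have "T \<le> (Im z)\<^sup>2" by (simp add: power2_eq_square)
    then have "Re (Digamma (z + of_nat N)) \<ge> Digamma 1 + (\<Sum>n<M. 1 / (2 * (1 + real n)))"
    proof (intro Re_Digamma_ge[of _ X])
      show "1 \<le> Re (z + of_nat N)" using z(1) N by simp
      show "Re (z + of_nat N) \<le> X" using z(1) by (simp add: X_def)
      show "2 * (X + real M) * (1 + real M) \<le> (Im (z + of_nat N))\<^sup>2"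
        using \<open>T \<le> (Im z)\<^sup>2\<close> by (simp add: T_def)
    qed
    then have 1: "Re (Digamma (z + of_nat N)) \<ge> B + real N" unfolding hs using M by simp
    have "Re (\<Sum>i<N. 1 / (z + of_nat i)) \<le> norm (\<Sum>i<N. 1 / (z + of_nat i))" by (rule complex_Re_le_cmod)
    also have "\<dots> \<le> (\<Sum>i<N. 1)"
    proof (rule sum_norm_le)
      fix i
      have "norm (z + of_nat i) \<ge> 1" using abs_Im_le_cmod[of "z + of_nat i"] z T1 by simp
      then show "norm (1 / (z + of_nat i)) \<le> 1" by (simp add: norm_divide divide_le_eq_1)
    qed
    finally show ?thesis using 1 shift[of N] by simp
  qed
  then show ?thesis using T1 by blast
qed

subsection \<open>Moments and the order of vanishing\<close>

text \<open>The operator $1 + 2y\,\frac{d}{dy}$ multiplies $y^m$ by $2m+1$ and lowers the order of vanishing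
  at $1$ by exactly one. Hence the power moments of the frequencies detect that order.\<close>

definition odd_weight_op :: "complex poly \<Rightarrow> complex poly" where
  "odd_weight_op p = p + smult 2 (pCons 0 (pderiv p))"

lemma odd_weight_op_add: "odd_weight_op (p + q) = odd_weight_op p + odd_weight_op q"
  by (simp add: odd_weight_op_def pderiv_add smult_add_right)

lemma odd_weight_op_sum: "odd_weight_op (sum f A) = (\<Sum>x\<in>A. odd_weight_op (f x))"
  by (induction A rule: infinite_finite_induct) (auto simp: odd_weight_op_add, simp_all add: odd_weight_op_def)

lemma odd_weight_op_monom: "odd_weight_op (monom c m) = monom (of_nat (2 * m + 1) * c) m"
  by (rule poly_eqI) (auto simp: odd_weight_op_def coeff_pCons coeff_pderiv algebra_simps split: nat.splits)

lemma odd_weight_op_funpow: "(odd_weight_op ^^ j) (\<Sum>m\<le>n. monom (a m) m) = (\<Sum>m\<le>n. monom (of_nat (2 * m + 1) ^ j * a m) m)"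
  by (induction j) (simp_all add: odd_weight_op_sum odd_weight_op_monom mult.assoc del: of_nat_Suc of_nat_add of_nat_mult)

text \<open>The operator sends (y - 1)^(k+1) q to (y - 1)^k q' with q'(1) = 2 (k + 1) q(1), which is
  again nonzero.\<close>

lemma odd_weight_op_order:
  assumes "poly q 1 \<noteq> 0" "p = [:-1, 1:] ^ k * q"
  shows "(\<forall>j<k. poly ((odd_weight_op ^^ j) p) 1 = 0) \<and> poly ((odd_weight_op ^^ k) p) 1 \<noteq> 0"
  using assms
proof (induction k arbitrary: p q)
  case (Suc k)
  define q' where "q' = [:-1, 1:] * q + smult 2 ([:0, 1:] * (smult (of_nat (Suc k)) q + [:-1, 1:] * pderiv q))"
  have "odd_weight_op p = [:-1, 1:] ^ k * q'"
  proof -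
    have "pderiv ([:-1, 1:] ^ Suc k :: complex poly) = smult (of_nat (Suc k)) ([:-1, 1:] ^ k)"
      by (subst pderiv_power_Suc) (simp add: pderiv_pCons)
    then have "pderiv p = [:-1, 1:] ^ k * (smult (of_nat (Suc k)) q + [:-1, 1:] * pderiv q)"
      unfolding Suc.prems(2) pderiv_mult by (simp add: algebra_simps del: of_nat_Suc)
    then have "odd_weight_op p = [:-1, 1:] ^ Suc k * q + smult 2 ([:0, 1:] * ([:-1, 1:] ^ k * (smult (of_nat (Suc k)) q + [:-1, 1:] * pderiv q)))"
      by (simp add: odd_weight_op_def Suc.prems(2))
    also have "\<dots> = [:-1, 1:] ^ k * q'"
      unfolding q'_def by (simp only: power_Suc mult_smult_right mult_smult_left distrib_left mult_ac)
    finally show ?thesis .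
  qed
  moreover have "poly q' 1 \<noteq> 0"
    using Suc.prems(1) by (simp add: q'_def del: of_nat_Suc)
  ultimately have IH: "\<forall>j<k. poly ((odd_weight_op ^^ j) (odd_weight_op p)) 1 = 0" "poly ((odd_weight_op ^^ k) (odd_weight_op p)) 1 \<noteq> 0"
    using Suc.IH by blast+
  have "poly ((odd_weight_op ^^ j) p) 1 = 0" if "j < Suc k" for j
    using that IH(1) Suc.prems(2) by (cases j) (simp_all add: funpow_Suc_right del: funpow.simps)
  then show ?case using IH(2) by (simp add: funpow_Suc_right del: funpow.simps)
qed simp

text \<open>Since 2 pi cosh t = pi e^t + pi e^(-t), the exponential prefactor of \<open>phiF\<close>
  turns 2 pi m into pi (2m + 1). The same numbers are the bases of the powers in
  \<open>psiF\<close>.\<close>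

definition freq :: "nat \<Rightarrow> real" where
  "freq m = pi * real (2 * m + 1)"

text \<open>The j-th moment of the frequencies is pi^j times the value at 1 of the j-fold image of P
  under \<open>odd_weight_op\<close>.\<close>

lemma moments_PF:
  assumes "\<exists>m\<le>n. a m \<noteq> 0"
  shows "j < order 1 (PF a n) \<Longrightarrow> (\<Sum>m\<le>n. a m * of_real (freq m) ^ j) = 0"
    and "(\<Sum>m\<le>n. a m * of_real (freq m) ^ order 1 (PF a n)) \<noteq> 0"
proof -
  have co: "coeff (PF a n) m = (if m \<le> n then a m else 0)" for m
    by (simp add: PF_def coeff_sum coeff_monom if_distrib cong: if_cong)
  have "PF a n \<noteq> 0"
  proof
    assume "PF a n = 0"
    then have "(if m \<le> n then a m else 0) = 0" for m using co[of m] by simp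
    then show False using assms by (metis (full_types))
  qed
  from order_decomp[OF this, of 1] obtain q where
    q: "PF a n = [:-1, 1:] ^ order 1 (PF a n) * q" "\<not> [:-1, 1:] dvd q" by auto
  have "poly q 1 \<noteq> 0" using q(2) by (simp add: poly_eq_0_iff_dvd)
  note mo = odd_weight_op_order[OF this q(1)]
  have eq: "(\<Sum>m\<le>n. a m * of_real (freq m) ^ j) = of_real pi ^ j * poly ((odd_weight_op ^^ j) (PF a n)) 1" for j
    unfolding PF_def odd_weight_op_funpow
    by (simp add: poly_sum poly_monom sum_distrib_left freq_def power_mult_distrib mult_ac)
  show "j < order 1 (PF a n) \<Longrightarrow> (\<Sum>m\<le>n. a m * of_real (freq m) ^ j) = 0"
    unfolding eq using mo by simp
  show "(\<Sum>m\<le>n. a m * of_real (freq m) ^ order 1 (PF a n)) \<noteq> 0"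
    unfolding eq using mo by simp
qed

text \<open>Makes every ln (freq m) positive, as \<open>expsum_not_constant\<close> and the growth
  bounds need.\<close>

lemma freq_gt_1: "freq m > 1"
proof -
  have "1 * 1 < pi * real (2 * m + 1)"
    using pi_gt3 by (intro mult_less_le_imp_less) auto
  then show ?thesis by (simp add: freq_def)
qed

lemma strict_mono_ln_freq: "strict_mono (\<lambda>m. ln (freq m))"
  by (rule strict_monoI) (use freq_gt_1 in \<open>simp add: freq_def\<close>)

lemma psiF_eq: "psiF a n s = (\<Sum>m\<le>n. a m * exp (- s * of_real (ln (freq m))))"
proof -
  have "complex_of_real pi powr (- s) * of_nat (2 * m + 1) powr (- s) = exp (- s * of_real (ln (freq m)))" for m
  proof -
    have "complex_of_real pi powr (- s) * of_real (real (2 * m + 1)) powr (- s) =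
        exp (- s * of_real (ln pi)) * exp (- s * of_real (ln (real (2 * m + 1))))"
    proof -
      have "x > 0 \<Longrightarrow> complex_of_real x powr (- s) = exp (- s * of_real (ln x))" for x
        by (simp add: powr_def Ln_of_real)
      from this[of pi] this[of "real (2 * m + 1)"] show ?thesis by simp
    qed
    also have "\<dots> = exp (- s * of_real (ln pi + ln (real (2 * m + 1))))"
      by (simp only: exp_add [symmetric] of_real_add distrib_left)
    also have "ln pi + ln (real (2 * m + 1)) = ln (freq m)"
      unfolding freq_def by (subst ln_mult) auto
    finally show ?thesis by simp
  qed
  then show ?thesis
    unfolding psiF_def sum_distrib_left by (intro sum.cong refl) (metis mult.left_commute)
qed

subsection \<open>Zeros of a function symmetrized across the imaginary axis\<close>

text \<open>\<open>L\<close> stands for the logarithmic derivative of g: along a horizontal line the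
  derivative of |g|^2 is 2 |g|^2 Re L.\<close>

lemma norm_increasing_of_log_deriv:
  fixes g L :: "complex \<Rightarrow> complex" and t :: real
  assumes "x1 < x2"
    and der: "\<And>x. x1 \<le> x \<Longrightarrow> x \<le> x2 \<Longrightarrow> (g has_field_derivative g (Complex x t) * L (Complex x t)) (at (Complex x t))"
    and nz: "\<And>x. x1 \<le> x \<Longrightarrow> x \<le> x2 \<Longrightarrow> g (Complex x t) \<noteq> 0"
    and pos: "\<And>x. x1 \<le> x \<Longrightarrow> x \<le> x2 \<Longrightarrow> Re (L (Complex x t)) > 0"
  shows "norm (g (Complex x1 t)) < norm (g (Complex x2 t))"
proof -
  define h where "h = (\<lambda>x. g (Complex x t))"
  have d: "((\<lambda>x. (Re (h x))\<^sup>2 + (Im (h x))\<^sup>2) has_field_derivative 2 * (norm (h x))\<^sup>2 * Re (L (Complex x t))) (at x)"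
    if "x1 \<le> x" "x \<le> x2" for x
  proof -
    define D where "D = g (Complex x t) * L (Complex x t)"
    have "((\<lambda>w. g (w + \<i> * of_real t)) has_field_derivative D) (at (of_real x))"
      using der[OF that] unfolding D_def Complex_eq
      by (subst (asm) DERIV_shift) simp
    from has_vector_derivative_real_field[OF this]
    have v: "(h has_vector_derivative D) (at x)"
      by (simp add: h_def Complex_eq)
    have "((\<lambda>x. (Re (h x))\<^sup>2 + (Im (h x))\<^sup>2) has_field_derivative 2 * Re (h x) * Re D + 2 * Im (h x) * Im D) (at x)"
      using v by (auto intro!: derivative_eq_intros)
    also have "2 * Re (h x) * Re D + 2 * Im (h x) * Im D = 2 * (norm (h x))\<^sup>2 * Re (L (Complex x t))"
      unfolding cmod_power2 by (simp add: D_def h_def algebra_simps power2_eq_square)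
    finally show ?thesis .
  qed
  have "(Re (h x1))\<^sup>2 + (Im (h x1))\<^sup>2 < (Re (h x2))\<^sup>2 + (Im (h x2))\<^sup>2"
  proof (rule DERIV_pos_imp_increasing[OF assms(1)])
    fix x assume x: "x1 \<le> x" "x \<le> x2"
    have "2 * (norm (h x))\<^sup>2 * Re (L (Complex x t)) > 0" using nz[OF x] pos[OF x] by (simp add: h_def)
    with d[OF x] show "\<exists>y. DERIV (\<lambda>x. (Re (h x))\<^sup>2 + (Im (h x))\<^sup>2) x :> y \<and> y > 0" by blast
  qed
  then have "(norm (h x1))\<^sup>2 < (norm (h x2))\<^sup>2" by (simp add: cmod_power2)
  then show ?thesis unfolding h_def by (simp add: power2_less_imp_less)
qed

text \<open>The point - cnj s is the mirror image of s on the same horizontal line, and a zero of C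
  makes |g| equal at the two. Monotonicity of |g| then excludes every zero off the axis at heights
  |Im s| >= T.\<close>

lemma finite_exceptional_zeros:
  fixes C g L :: "complex \<Rightarrow> complex" and \<delta> T :: real
  assumes hol: "C holomorphic_on UNIV"
    and C: "\<And>s. \<bar>Im s\<bar> \<ge> T \<Longrightarrow> C s = g s + cnj (g (- cnj s))"
    and der: "\<And>s. \<bar>Re s\<bar> \<le> \<delta> \<Longrightarrow> \<bar>Im s\<bar> \<ge> T \<Longrightarrow> (g has_field_derivative g s * L s) (at s)"
    and nz: "\<And>s. \<bar>Re s\<bar> \<le> \<delta> \<Longrightarrow> \<bar>Im s\<bar> \<ge> T \<Longrightarrow> g s \<noteq> 0"
    and pos: "\<And>s. \<bar>Re s\<bar> \<le> \<delta> \<Longrightarrow> \<bar>Im s\<bar> \<ge> T \<Longrightarrow> Re (L s) > 0"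
    and "\<delta> > 0"
  shows "finite {s. C s = 0 \<and> \<bar>Re s\<bar> \<le> \<delta> \<and> \<not> (Re s = 0 \<and> deriv C s \<noteq> 0)}"
proof -
  have inc: "norm (g (Complex (- \<sigma>) t)) < norm (g (Complex \<sigma> t))"
    if "0 < \<sigma>" "\<sigma> \<le> \<delta>" "\<bar>t\<bar> \<ge> T" for \<sigma> t
  proof (rule norm_increasing_of_log_deriv[of "- \<sigma>" \<sigma> g t L])
    fix x assume "- \<sigma> \<le> x" "x \<le> \<sigma>"
    then have x: "\<bar>Re (Complex x t)\<bar> \<le> \<delta>" "\<bar>Im (Complex x t)\<bar> \<ge> T" using that by auto
    show "(g has_field_derivative g (Complex x t) * L (Complex x t)) (at (Complex x t))"
      "g (Complex x t) \<noteq> 0" "Re (L (Complex x t)) > 0"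
      using der[OF x] nz[OF x] pos[OF x] by auto
  qed (use that in auto)
  have axis: "C s \<noteq> 0" if "\<bar>Re s\<bar> \<le> \<delta>" "Re s \<noteq> 0" "\<bar>Im s\<bar> \<ge> T" for s
  proof
    assume "C s = 0"
    then have "norm (g s) = norm (g (- cnj s))"
      using C[OF that(3)] by (metis add_eq_0_iff complex_mod_cnj norm_minus_cancel)
    moreover have "norm (g s) \<noteq> norm (g (- cnj s))"
    proof (cases "Re s > 0")
      case True
      have "s = Complex (Re s) (Im s)" "- cnj s = Complex (- Re s) (Im s)" by (simp_all add: complex_eq_iff)
      then show ?thesis using inc[of "Re s" "Im s"] that True by (metis abs_le_D1 less_irrefl)
    next
      case False
      have "s = Complex (- (- Re s)) (Im s)" "- cnj s = Complex (- Re s) (Im s)" by (simp_all add: complex_eq_iff)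
      moreover have "- Re s > 0" "- Re s \<le> \<delta>" using False that by auto
      ultimately show ?thesis using inc[of "- Re s" "Im s"] that by (metis less_irrefl)
    qed
    ultimately show False by simp
  qed
  \<comment> \<open>The inequality is strict because the formula for C has to hold in a
    neighbourhood of s; zeros at height T itself fall into the box \<open>K\<close>.\<close>
  have simple: "deriv C s \<noteq> 0" if "C s = 0" "Re s = 0" "\<bar>Im s\<bar> > T" for s
  proof -
    have s: "\<bar>Re s\<bar> \<le> \<delta>" "\<bar>Im s\<bar> \<ge> T" and ms: "- cnj s = s"
      using that \<open>\<delta> > 0\<close> by (auto simp: complex_eq_iff)
    \<comment> \<open>The reflected summand is \<open>G\<close> conjugated on both sides, and on the
      axis - cnj s = s, so its derivative involves g and L at s only.\<close>
    define G where "G = (\<lambda>w. g (- w))"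
    have "(g has_field_derivative g s * L s) (at (- cnj s))" using der[OF s] by (simp add: ms)
    from DERIV_chain2[OF this DERIV_minus[OF DERIV_ident]]
    have "(G has_field_derivative - (g s * L s)) (at (cnj s))"
      by (simp add: G_def)
    from has_field_derivative_cnj_cnj[OF this]
    have "((\<lambda>z. cnj (g (- cnj z))) has_field_derivative cnj (- (g s * L s))) (at s)"
      by (simp add: o_def G_def)
    from DERIV_add[OF der[OF s] this]
    have D: "((\<lambda>z. g z + cnj (g (- cnj z))) has_field_derivative g s * L s + cnj (- (g s * L s))) (at s)" .
    have op: "open {z. \<bar>Im z\<bar> > T}"
      by (intro open_Collect_less continuous_intros)
    have "(C has_field_derivative g s * L s + cnj (- (g s * L s))) (at s)"
      by (rule has_field_derivative_transform_within_open[OF D op]) (use that C in auto)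
    then have "deriv C s = g s * L s - cnj (g s) * cnj (L s)" by (simp add: DERIV_imp_deriv)
    also have "cnj (g s) = - g s" using C[OF s(2)] that(1) ms by (simp add: add_eq_0_iff)
    also have "g s * L s - - g s * cnj (L s) = g s * (L s + cnj (L s))" by (simp add: algebra_simps)
    also have "L s + cnj (L s) = of_real (2 * Re (L s))" by (simp add: complex_eq_iff)
    finally show ?thesis using nz[OF s] pos[OF s] by simp
  qed
  \<comment> \<open>T may have either sign, so the box is bounded by its absolute value.\<close>
  define K where "K = cbox (Complex (- \<delta>) (- \<bar>T\<bar>)) (Complex \<delta> \<bar>T\<bar>)"
  have sub: "{s. C s = 0 \<and> \<bar>Re s\<bar> \<le> \<delta> \<and> \<not> (Re s = 0 \<and> deriv C s \<noteq> 0)} \<subseteq> {s\<in>K. C s = 0}"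
  proof
    fix s assume "s \<in> {s. C s = 0 \<and> \<bar>Re s\<bar> \<le> \<delta> \<and> \<not> (Re s = 0 \<and> deriv C s \<noteq> 0)}"
    then have s: "C s = 0" "\<bar>Re s\<bar> \<le> \<delta>" "\<not> (Re s = 0 \<and> deriv C s \<noteq> 0)" by auto
    have "\<bar>Im s\<bar> \<le> \<bar>T\<bar>" using axis[of s] simple[of s] s by force
    then show "s \<in> {s\<in>K. C s = 0}" using s(1,2) by (auto simp: K_def in_cbox_complex_iff)
  qed
  have "finite {s\<in>K. C s = 0}"
  proof (cases "C constant_on UNIV")
    case True
    then obtain c where c: "\<And>s. C s = c" by (auto simp: constant_on_def)
    \<comment> \<open>At a point off the axis and at height |T|, \<open>axis\<close> applies, so a
      constant C is not zero.\<close>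
    have "C (Complex \<delta> \<bar>T\<bar>) \<noteq> 0" using \<open>\<delta> > 0\<close> by (intro axis) auto
    then show ?thesis by (simp add: c)
  next
    case False
    then show ?thesis
      by (intro holomorphic_compact_finite_zeros[OF hol]) (auto simp: K_def)
  qed
  then show ?thesis using sub finite_subset by blast
qed

subsection \<open>The decomposition of the transform\<close>

lemma CF_eq_sum_bessel_integral: "CF a n s = (\<Sum>m\<le>n. \<Sum>l\<le>n. a m * cnj (a l) * bessel_integral (freq m) (freq l) s)"
proof -
  define E where "E = (\<lambda>m l t. exp (of_real (- freq m * exp t - freq l * exp (- t)) + s * complex_of_real t))"
  have "phiF a n t * exp (\<i> * (- \<i> * s) * of_real t) = (\<Sum>m\<le>n. \<Sum>l\<le>n. a m * cnj (a l) * E m l t)" for t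
  proof -
    have e: "complex_of_real (exp (- 2 * pi * cosh t)) * of_real (exp (- 2 * pi * real m * exp t)) *
        of_real (exp (- 2 * pi * real l * exp (- t))) * exp (s * of_real t) = E m l t" for m l
    proof -
      have "exp (- 2 * pi * cosh t) * exp (- 2 * pi * real m * exp t) * exp (- 2 * pi * real l * exp (- t)) =
          exp (- freq m * exp t - freq l * exp (- t))"
        unfolding exp_add [symmetric] by (rule arg_cong[of _ _ exp]) (simp add: cosh_def freq_def algebra_simps)
      then have "complex_of_real (exp (- 2 * pi * cosh t)) * of_real (exp (- 2 * pi * real m * exp t)) *
          of_real (exp (- 2 * pi * real l * exp (- t))) = of_real (exp (- freq m * exp t - freq l * exp (- t)))"
        by (simp only: of_real_mult [symmetric])
      then show ?thesis by (simp only: E_def exp_add exp_of_real)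
    qed
    have "phiF a n t * exp (\<i> * (- \<i> * s) * of_real t) =
       (\<Sum>m\<le>n. \<Sum>l\<le>n. a m * cnj (a l) * (complex_of_real (exp (- 2 * pi * cosh t)) * of_real (exp (- 2 * pi * real m * exp t)) *
        of_real (exp (- 2 * pi * real l * exp (- t))) * exp (s * of_real t)))"
      unfolding phiF_def sum_distrib_left sum_distrib_right sum_product
      by (subst sum.swap) (simp add: mult_ac)
    then show ?thesis by (simp only: e)
  qed
  then have "CF a n s = (LBINT t. \<Sum>m\<le>n. \<Sum>l\<le>n. a m * cnj (a l) * E m l t)"
    by (simp only: CF_def XiF_def)
  also have "\<dots> = (\<Sum>m\<le>n. \<Sum>l\<le>n. a m * cnj (a l) * (LBINT t. E m l t))"
  proof -
    have "integrable lborel (E m l)" for m l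
      unfolding E_def using freq_gt_1[of m] freq_gt_1[of l] by (intro integrable_bessel_integrand) auto
    then show ?thesis by simp
  qed
  finally show ?thesis by (simp only: E_def bessel_integral_def)
qed

lemma CF_holomorphic: "CF a n holomorphic_on UNIV"
proof -
  have "(\<lambda>s. \<Sum>m\<le>n. \<Sum>l\<le>n. a m * cnj (a l) * bessel_integral (freq m) (freq l) s) holomorphic_on UNIV"
    using freq_gt_1 by (intro holomorphic_intros bessel_integral_holomorphic) (auto intro: less_trans[OF zero_less_one])
  then show ?thesis by (simp add: CF_eq_sum_bessel_integral [abs_def])
qed

text \<open>The function g of the splitting of \<open>CF\<close>.\<close>

definition CF_part :: "(nat \<Rightarrow> complex) \<Rightarrow> nat \<Rightarrow> complex \<Rightarrow> complex" where
  "CF_part a n s = (\<Sum>m\<le>n. \<Sum>l\<le>n. a m * cnj (a l) * bessel_part (freq m) (freq l) s)"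

lemma cnj_hyp01:
  assumes "\<bar>Im z\<bar> \<ge> 1"
  shows "cnj (hyp01 x z) = hyp01 (cnj x) (cnj z)"
proof -
  have "(\<lambda>j. cnj (x ^ j / (fact j * pochhammer z j))) sums cnj (hyp01 x z)"
    using hyp01_sums[OF assms] by (simp only: sums_cnj)
  moreover have "cnj (x ^ j / (fact j * pochhammer z j)) = cnj x ^ j / (fact j * pochhammer (cnj z) j)" for j
    by simp
  ultimately have "(\<lambda>j. cnj x ^ j / (fact j * pochhammer (cnj z) j)) sums cnj (hyp01 x z)" by simp
  moreover have "(\<lambda>j. cnj x ^ j / (fact j * pochhammer (cnj z) j)) sums hyp01 (cnj x) (cnj z)"
    using assms by (intro hyp01_sums) simp
  ultimately show ?thesis by (rule sums_unique2)
qed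

lemma cnj_bessel_part:
  assumes "\<bar>Im s\<bar> \<ge> 1"
  shows "cnj (bessel_part \<alpha> \<beta> s) = bessel_part \<alpha> \<beta> (cnj s)"
proof -
  have "cnj (hyp01 (of_real (\<alpha> * \<beta>)) (1 - s)) = hyp01 (of_real (\<alpha> * \<beta>)) (1 - cnj s)"
    using assms by (subst cnj_hyp01) auto
  then show ?thesis by (simp add: bessel_part_def scaled_Gamma_def cnj_Gamma exp_cnj)
qed

text \<open>Exchanging the two summation indices conjugates the coefficient a m * cnj (a l). As the
  frequencies are real, the second halves of the connection formulas add up to the reflected
  conjugate of the first halves.\<close>

lemma CF_eq_CF_part:
  assumes "\<bar>Im s\<bar> \<ge> 1"
  shows "CF a n s = CF_part a n s + cnj (CF_part a n (- cnj s))"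
proof -
  have f: "freq m > 0" for m using freq_gt_1[of m] by linarith
  have "CF a n s = (\<Sum>m\<le>n. \<Sum>l\<le>n. a m * cnj (a l) * (bessel_part (freq m) (freq l) s + bessel_part (freq l) (freq m) (- s)))"
    unfolding CF_eq_sum_bessel_integral using bessel_integral_eq_sum[OF f f assms] by simp
  also have "\<dots> = CF_part a n s + (\<Sum>m\<le>n. \<Sum>l\<le>n. a m * cnj (a l) * bessel_part (freq l) (freq m) (- s))"
    by (simp add: CF_part_def distrib_left sum.distrib)
  also have "(\<Sum>m\<le>n. \<Sum>l\<le>n. a m * cnj (a l) * bessel_part (freq l) (freq m) (- s)) =
      (\<Sum>l\<le>n. \<Sum>m\<le>n. a m * cnj (a l) * bessel_part (freq l) (freq m) (- s))"
    by (rule sum.swap)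
  also have "\<dots> = cnj (CF_part a n (- cnj s))"
  proof -
    have "cnj (bessel_part \<alpha> \<beta> (- cnj s)) = bessel_part \<alpha> \<beta> (- s)" for \<alpha> \<beta>
      using cnj_bessel_part[of "- cnj s" \<alpha> \<beta>] assms by simp
    then show ?thesis by (simp add: CF_part_def mult_ac)
  qed
  finally show ?thesis .
qed

section \<open>Factoring the split part: Gamma times a series led by psi_F(s - k)\<close>

definition conj_moment :: "(nat \<Rightarrow> complex) \<Rightarrow> nat \<Rightarrow> nat \<Rightarrow> complex" where
  "conj_moment a n j = (\<Sum>l\<le>n. cnj (a l) * of_real (freq l) ^ j)"

text \<open>Summing the ${}_0F_1$ series over the pairs of frequencies, the first $k$ terms vanish with the
  moments, and the next one is a multiple of $\psi_F(s-k)$.\<close>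

definition CF_series_term :: "(nat \<Rightarrow> complex) \<Rightarrow> nat \<Rightarrow> nat \<Rightarrow> nat \<Rightarrow> complex \<Rightarrow> complex" where
  "CF_series_term a n k i s = conj_moment a n (k + i) / fact (k + i) * psiF a n (s - of_nat (k + i))
     / pochhammer (1 - s + of_nat k) i"

text \<open>The function h of the factorization g(s) = (-1)^k Gamma(s - k) h(s).\<close>

definition CF_series :: "(nat \<Rightarrow> complex) \<Rightarrow> nat \<Rightarrow> nat \<Rightarrow> complex \<Rightarrow> complex" where
  "CF_series a n k s = (\<Sum>i. CF_series_term a n k i s)"

text \<open>In the j-th term the power of \<open>freq m\<close> shifts the exponent from s to s - j,
  so the double sum factors into \<open>psiF\<close> at s - j and the j-th moment. The terms with j
  < k vanish; the common factor \<open>pochhammer (1 - s) k\<close> of the other denominators turns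
  Gamma s into (-1)^k Gamma (s - k).\<close>

lemma CF_part_eq_Gamma_mult_series:
  assumes s: "\<bar>Im s\<bar> \<ge> 1" and mom: "\<And>j. j < k \<Longrightarrow> conj_moment a n j = 0"
  shows "CF_part a n s = (-1) ^ k * Gamma (s - of_nat k) * CF_series a n k s"
proof -
  define f where "f = (\<lambda>j. conj_moment a n j * psiF a n (s - of_nat j) / (fact j * pochhammer (1 - s) j))"
  define S where "S = (\<Sum>m\<le>n. \<Sum>l\<le>n. a m * cnj (a l) * exp (- s * of_real (ln (freq m))) *
     hyp01 (of_real (freq m * freq l)) (1 - s))"
  have gS: "CF_part a n s = Gamma s * S"
    by (simp add: CF_part_def S_def bessel_part_def scaled_Gamma_def sum_distrib_left mult_ac)
  have "(\<lambda>j. \<Sum>m\<le>n. \<Sum>l\<le>n. a m * cnj (a l) * exp (- s * of_real (ln (freq m))) *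
      (of_real (freq m * freq l) ^ j / (fact j * pochhammer (1 - s) j))) sums S"
    unfolding S_def using s by (intro sums_sum sums_mult hyp01_sums) auto
  also have "(\<lambda>j. \<Sum>m\<le>n. \<Sum>l\<le>n. a m * cnj (a l) * exp (- s * of_real (ln (freq m))) *
      (of_real (freq m * freq l) ^ j / (fact j * pochhammer (1 - s) j))) = f"
  proof
    fix j
    have e: "exp (- (s - of_nat j) * of_real (ln (freq m))) = exp (- s * of_real (ln (freq m))) * of_real (freq m) ^ j" for m
    proof -
      have "exp (- (s - of_nat j) * of_real (ln (freq m))) = exp (- s * of_real (ln (freq m))) * exp (of_nat j * of_real (ln (freq m)))"
        unfolding exp_add [symmetric] by (simp add: algebra_simps)
      also have "exp (of_nat j * of_real (ln (freq m))) = complex_of_real (freq m) ^ j"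
        using freq_gt_1[of m] by (simp add: exp_of_nat_mult exp_of_real)
      finally show ?thesis .
    qed
    have "f j = (\<Sum>m\<le>n. \<Sum>l\<le>n. (a m * exp (- (s - of_nat j) * of_real (ln (freq m)))) * (cnj (a l) * of_real (freq l) ^ j)) / (fact j * pochhammer (1 - s) j)"
      unfolding f_def conj_moment_def psiF_eq by (subst mult.commute) (simp only: sum_product)
    also have "\<dots> = (\<Sum>m\<le>n. \<Sum>l\<le>n. a m * cnj (a l) * exp (- s * of_real (ln (freq m))) *
      (of_real (freq m * freq l) ^ j / (fact j * pochhammer (1 - s) j)))"
      unfolding e sum_divide_distrib
      by (intro sum.cong refl) (simp add: power_mult_distrib)
    finally show "(\<Sum>m\<le>n. \<Sum>l\<le>n. a m * cnj (a l) * exp (- s * of_real (ln (freq m))) *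
      (of_real (freq m * freq l) ^ j / (fact j * pochhammer (1 - s) j))) = f j" by simp
  qed
  finally have "f sums S" .
  moreover have "(\<Sum>i<k. f i) = 0" using mom by (simp add: f_def)
  ultimately have "(\<lambda>i. f (i + k)) sums S" using sums_iff_shift[of f k S] by simp
  moreover have "f (i + k) = CF_series_term a n k i s / pochhammer (1 - s) k" for i
    by (simp add: f_def CF_series_term_def add.commute[of i k] pochhammer_product' mult_ac)
  ultimately have "(\<lambda>i. CF_series_term a n k i s / pochhammer (1 - s) k) sums S" by simp
  from sums_mult[OF this, of "pochhammer (1 - s) k"]
  have "(\<lambda>i. CF_series_term a n k i s) sums (pochhammer (1 - s) k * S)"
    using pochhammer_nonzero_of_Im[of "1 - s" k] s by simp
  then have h: "CF_series a n k s = pochhammer (1 - s) k * S" by (simp add: CF_series_def sums_iff)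
  have "s - of_nat k \<notin> \<int>\<^sub>\<le>\<^sub>0" using s by (intro not_nonpos_Int_of_Im) simp
  from pochhammer_Gamma[OF this, of k]
  have "Gamma s = pochhammer (s - of_nat k) k * Gamma (s - of_nat k)"
    using Gamma_nonzero_of_Im[of "s - of_nat k"] s by simp
  also have "pochhammer (s - of_nat k) k = (-1) ^ k * pochhammer (1 - s) k"
    using pochhammer_minus'[of "s - 1" k] by (simp add: algebra_simps)
  finally show ?thesis unfolding gS h by simp
qed

text \<open>Moment and \<open>psiF\<close> each grow at most like the j-th power of the largest
  frequency. The Pochhammer denominator is left out here because it is estimated in two ways later:
  from below by 1, and by |Im s|.\<close>

lemma CF_series_coeff_bound:
  "\<exists>B\<ge>0. \<forall>i s. \<bar>Re s\<bar> \<le> R \<longrightarrow>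
     norm (conj_moment a n (k + i) / fact (k + i) * psiF a n (s - of_nat (k + i))) \<le> B * (((freq n)\<^sup>2) ^ i / fact i)"
proof -
  define X where "X = freq n"
  define A where "A = (\<Sum>m\<le>n. norm (a m))"
  have X1: "X > 1" using freq_gt_1 by (simp add: X_def)
  have A0: "A \<ge> 0" by (simp add: A_def sum_nonneg)
  have fX: "freq m \<le> X" if "m \<le> n" for m using that by (simp add: X_def freq_def)
  define B where "B = A\<^sup>2 * exp (R * ln X) * (X\<^sup>2) ^ k"
  have "norm (conj_moment a n (k + i) / fact (k + i) * psiF a n (s - of_nat (k + i))) \<le> B * ((X\<^sup>2) ^ i / fact i)"
    if "\<bar>Re s\<bar> \<le> R" for i s
  proof -
    define j where "j = k + i"
    have "norm (conj_moment a n j) \<le> (\<Sum>l\<le>n. norm (a l) * X ^ j)"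
      unfolding conj_moment_def
    proof (rule sum_norm_le)
      fix l assume "l \<in> {..n}"
      then have "freq l ^ j \<le> X ^ j" using fX freq_gt_1[of l] by (intro power_mono) auto
      then show "norm (cnj (a l) * of_real (freq l) ^ j) \<le> norm (a l) * X ^ j"
        using freq_gt_1[of l] by (simp add: norm_mult norm_power mult_left_mono)
    qed
    also have "\<dots> = A * X ^ j" by (simp add: A_def sum_distrib_right)
    finally have 1: "norm (conj_moment a n j) \<le> A * X ^ j" .
    have "norm (psiF a n (s - of_nat j)) \<le> (\<Sum>m\<le>n. norm (a m) * (exp (R * ln X) * X ^ j))"
      unfolding psiF_eq
    proof (rule sum_norm_le)
      fix m assume m: "m \<in> {..n}"
      have l: "0 \<le> ln (freq m)" "ln (freq m) \<le> ln X" using fX[of m] m freq_gt_1[of m] by auto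
      have "(real j - Re s) * ln (freq m) \<le> (real j + R) * ln (freq m)"
        using that l by (intro mult_right_mono) auto
      also have "\<dots> \<le> (real j + R) * ln X" using that l by (intro mult_left_mono) auto
      finally have "exp ((real j - Re s) * ln (freq m)) \<le> exp ((real j + R) * ln X)" by simp
      also have "\<dots> = exp (R * ln X) * X ^ j"
        using X1 by (simp add: distrib_right exp_add exp_of_nat_mult)
      finally have e: "exp ((real j - Re s) * ln (freq m)) \<le> exp (R * ln X) * X ^ j" .
      have "norm (a m * exp (- (s - of_nat j) * of_real (ln (freq m)))) = norm (a m) * exp ((real j - Re s) * ln (freq m))"
        by (simp add: norm_mult)
      also have "\<dots> \<le> norm (a m) * (exp (R * ln X) * X ^ j)" by (rule mult_left_mono[OF e]) simp
      finally show "norm (a m * exp (- (s - of_nat j) * of_real (ln (freq m)))) \<le> norm (a m) * (exp (R * ln X) * X ^ j)" .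
    qed
    also have "\<dots> = A * (exp (R * ln X) * X ^ j)" by (simp add: A_def sum_distrib_right)
    finally have 2: "norm (psiF a n (s - of_nat j)) \<le> A * (exp (R * ln X) * X ^ j)" .
    have "norm (conj_moment a n j / fact j * psiF a n (s - of_nat j)) = norm (conj_moment a n j) * norm (psiF a n (s - of_nat j)) / fact j"
      by (simp add: norm_mult norm_divide)
    also have "\<dots> \<le> (A * X ^ j) * (A * (exp (R * ln X) * X ^ j)) / fact j"
      using A0 X1 by (intro divide_right_mono mult_mono 1 2) auto
    also have "\<dots> \<le> (A * X ^ j) * (A * (exp (R * ln X) * X ^ j)) / fact i"
      using A0 X1 by (intro divide_left_mono fact_mono) (auto simp: j_def)
    also have "\<dots> = B * ((X\<^sup>2) ^ i / fact i)"
      by (simp add: B_def j_def power_add power2_eq_square power_mult_distrib mult_ac)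
    finally show ?thesis by (simp add: j_def)
  qed
  moreover have "B \<ge> 0" by (simp add: B_def)
  ultimately show ?thesis unfolding X_def by blast
qed

text \<open>One constant for three uses: uniform convergence of the series, Cauchy's estimate for
  its derivative, and closeness to the leading term. The last gains 1 / |Im s| because each later
  Pochhammer symbol contains the factor 1 - s + k.\<close>

lemma CF_series_bounds:
  "\<exists>B\<ge>0. (\<forall>i s. \<bar>Re s\<bar> \<le> R \<longrightarrow> \<bar>Im s\<bar> \<ge> 1 \<longrightarrow> norm (CF_series_term a n k i s) \<le> B * (((freq n)\<^sup>2) ^ i / fact i)) \<and>
     (\<forall>s. \<bar>Re s\<bar> \<le> R \<longrightarrow> \<bar>Im s\<bar> \<ge> 1 \<longrightarrow> norm (CF_series a n k s) \<le> B * exp ((freq n)\<^sup>2)) \<and>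
     (\<forall>s. \<bar>Re s\<bar> \<le> R \<longrightarrow> \<bar>Im s\<bar> \<ge> 1 \<longrightarrow> norm (CF_series a n k s - CF_series_term a n k 0 s) \<le> B * exp ((freq n)\<^sup>2) / \<bar>Im s\<bar>)"
proof -
  define Q where "Q = (freq n)\<^sup>2"
  have Q0: "Q \<ge> 0" by (simp add: Q_def)
  obtain B where B: "B \<ge> 0" and cb: "\<And>i s. \<bar>Re s\<bar> \<le> R \<Longrightarrow>
     norm (conj_moment a n (k + i) / fact (k + i) * psiF a n (s - of_nat (k + i))) \<le> B * (Q ^ i / fact i)"
    unfolding Q_def using CF_series_coeff_bound[of R a n k] by blast
  have es: "(\<lambda>i. Q ^ i / fact i) sums exp Q"
    using exp_converges[of Q] by (simp add: divide_inverse mult.commute)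
  have es': "(\<lambda>i. B * (Q ^ i / fact i)) sums (B * exp Q)" by (intro sums_mult es)
  have t1: "norm (CF_series_term a n k i s) \<le> B * (Q ^ i / fact i)" if s: "\<bar>Re s\<bar> \<le> R" "\<bar>Im s\<bar> \<ge> 1" for i s
  proof -
    have p: "norm (pochhammer (1 - s + of_nat k) i) \<ge> 1" using s by (intro norm_pochhammer_ge) simp
    have "norm (CF_series_term a n k i s) \<le> B * (Q ^ i / fact i) / norm (pochhammer (1 - s + of_nat k) i)"
      unfolding CF_series_term_def norm_divide[of _ "pochhammer _ _"] by (rule divide_right_mono[OF cb[OF s(1)]]) simp
    also have "\<dots> \<le> B * (Q ^ i / fact i) / 1"
      using p B Q0 by (intro divide_left_mono) auto
    finally show ?thesis by simp
  qed
  have t2: "norm (CF_series_term a n k (Suc i) s) \<le> B * (Q ^ Suc i / fact (Suc i)) / \<bar>Im s\<bar>" if s: "\<bar>Re s\<bar> \<le> R" "\<bar>Im s\<bar> \<ge> 1" for i s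
  proof -
    have "norm (pochhammer (1 - s + of_nat k) (Suc i)) \<ge> norm (1 - s + of_nat k)" using s by (intro norm_pochhammer_ge) simp
    moreover have "norm (1 - s + of_nat k) \<ge> \<bar>Im s\<bar>" using abs_Im_le_cmod[of "1 - s + of_nat k"] by simp
    ultimately have p: "norm (pochhammer (1 - s + of_nat k) (Suc i)) \<ge> \<bar>Im s\<bar>" by linarith
    have "norm (CF_series_term a n k (Suc i) s) \<le> B * (Q ^ Suc i / fact (Suc i)) / norm (pochhammer (1 - s + of_nat k) (Suc i))"
      unfolding CF_series_term_def norm_divide[of _ "pochhammer _ _"] by (rule divide_right_mono[OF cb[OF s(1)]]) simp
    also have "\<dots> \<le> B * (Q ^ Suc i / fact (Suc i)) / \<bar>Im s\<bar>"
      using p s B Q0 by (intro divide_left_mono mult_pos_pos) (auto intro: less_le_trans[of 0 "\<bar>Im s\<bar>"])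
    finally show ?thesis .
  qed
  have sm: "summable (\<lambda>i. CF_series_term a n k i s)" if "\<bar>Re s\<bar> \<le> R" "\<bar>Im s\<bar> \<ge> 1" for s
    by (rule summable_comparison_test'[OF sums_summable[OF es']]) (rule t1[OF that])
  have "norm (CF_series a n k s) \<le> B * exp Q" if "\<bar>Re s\<bar> \<le> R" "\<bar>Im s\<bar> \<ge> 1" for s
    unfolding CF_series_def sums_unique[OF es'] by (rule norm_suminf_le[OF t1[OF that] sums_summable[OF es']])
  moreover have "norm (CF_series a n k s - CF_series_term a n k 0 s) \<le> B * exp Q / \<bar>Im s\<bar>" if s: "\<bar>Re s\<bar> \<le> R" "\<bar>Im s\<bar> \<ge> 1" for s
  proof -
    have "(\<lambda>i. B * (Q ^ Suc i / fact (Suc i))) sums (B * exp Q - B)"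
      using es' by (subst sums_Suc_iff) simp
    then have es2: "(\<lambda>i. B * (Q ^ Suc i / fact (Suc i)) / \<bar>Im s\<bar>) sums ((B * exp Q - B) / \<bar>Im s\<bar>)"
      by (rule sums_divide)
    have "CF_series a n k s - CF_series_term a n k 0 s = (\<Sum>i. CF_series_term a n k (Suc i) s)"
      unfolding CF_series_def using suminf_split_head[OF sm[OF s]] by simp
    also have "norm \<dots> \<le> (\<Sum>i. B * (Q ^ Suc i / fact (Suc i)) / \<bar>Im s\<bar>)"
      by (rule norm_suminf_le[OF t2[OF s] sums_summable[OF es2]])
    also have "\<dots> = (B * exp Q - B) / \<bar>Im s\<bar>" using es2 by (simp add: sums_iff)
    also have "\<dots> \<le> B * exp Q / \<bar>Im s\<bar>" using B by (intro divide_right_mono) auto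
    finally show ?thesis .
  qed
  ultimately show ?thesis using B t1 unfolding Q_def by blast
qed

lemma holomorphic_pochhammer_affine: "(\<lambda>s. pochhammer (1 - s + c) i) holomorphic_on A" for c :: complex
  by (induction i) (auto simp: pochhammer_Suc intro!: holomorphic_intros)

lemma CF_series_holomorphic: "CF_series a n k holomorphic_on {s. \<bar>Im s\<bar> > 1}"
proof (rule holomorphic_uniform_sequence)
  show op: "open {s. \<bar>Im s\<bar> > 1}" by (intro open_Collect_less continuous_intros)
  show "(\<lambda>s. \<Sum>i<N. CF_series_term a n k i s) holomorphic_on {s. \<bar>Im s\<bar> > 1}" for N
    unfolding CF_series_term_def psiF_eq
    by (intro holomorphic_intros holomorphic_pochhammer_affine pochhammer_nonzero_of_Im) auto
  fix x :: complex assume "x \<in> {s. \<bar>Im s\<bar> > 1}"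
  then obtain d where d: "d > 0" "cball x d \<subseteq> {s. \<bar>Im s\<bar> > 1}"
    using op open_contains_cball by blast
  obtain B where B: "\<And>i s. \<bar>Re s\<bar> \<le> \<bar>Re x\<bar> + d \<Longrightarrow> \<bar>Im s\<bar> \<ge> 1 \<Longrightarrow> norm (CF_series_term a n k i s) \<le> B * (((freq n)\<^sup>2) ^ i / fact i)"
    using CF_series_bounds[of "\<bar>Re x\<bar> + d" a n k] by blast
  have "uniform_limit (cball x d) (\<lambda>N s. \<Sum>i<N. CF_series_term a n k i s) (\<lambda>s. suminf (\<lambda>i. CF_series_term a n k i s)) sequentially"
  proof (rule Weierstrass_m_test)
    fix i s assume s: "s \<in> cball x d"
    have "\<bar>Re s - Re x\<bar> \<le> d"
      using s abs_Re_le_cmod[of "s - x"] by (simp add: dist_norm norm_minus_commute)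
    moreover have "\<bar>Im s\<bar> \<ge> 1" using s d by force
    ultimately show "norm (CF_series_term a n k i s) \<le> B * (((freq n)\<^sup>2) ^ i / fact i)" by (intro B) auto
  next
    show "summable (\<lambda>i. B * (((freq n)\<^sup>2) ^ i / fact i))"
      using summable_exp_generic[of "(freq n)\<^sup>2"] by (intro summable_mult) (simp add: divide_inverse mult.commute)
  qed
  then show "\<exists>d>0. cball x d \<subseteq> {s. \<bar>Im s\<bar> > 1} \<and>
      uniform_limit (cball x d) (\<lambda>N s. \<Sum>i<N. CF_series_term a n k i s) (CF_series a n k) sequentially"
    using d unfolding CF_series_def by blast
qed

section \<open>Assembly: lower bound for the series, its logarithmic derivative, and the choice of
  the height\<close>

theorem theorem3:
  fixes a :: "nat \<Rightarrow> complex" and n k :: nat and D1 D2 \<delta> :: real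
  assumes nonzero: "\<exists>m\<le>n. a m \<noteq> 0"
    and k_def: "k = order 1 (PF a n)"
    and D1_pos: "0 < D1" and D1_D2: "D1 < D2"
    and no_zeros: "\<And>s. - D2 < Re s \<Longrightarrow> Re s < D1 \<Longrightarrow> psiF a n (s - of_nat k) \<noteq> 0"
    and delta: "0 < \<delta>" "\<delta> < D1"
  shows "finite {s. CF a n s = 0 \<and> \<bar>Re s\<bar> \<le> \<delta> \<and> \<not> (Re s = 0 \<and> deriv (CF a n) s \<noteq> 0)}"
proof -
  have mb: "conj_moment a n j = cnj (\<Sum>m\<le>n. a m * of_real (freq m) ^ j)" for j
    by (simp add: conj_moment_def)
  have mom0: "conj_moment a n j = 0" if "j < k" for j
    using moments_PF(1)[OF nonzero, of j] that by (simp only: mb k_def complex_cnj_zero)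
  have momk: "conj_moment a n k \<noteq> 0"
    using moments_PF(2)[OF nonzero] by (simp only: mb k_def complex_cnj_zero_iff not_False_eq_True)
  have "\<exists>e>0. \<forall>z. - \<delta> - real k \<le> Re z \<longrightarrow> Re z \<le> \<delta> - real k \<longrightarrow> norm (\<Sum>m\<le>n. a m * exp (- z * of_real (ln (freq m)))) \<ge> e"
  \<comment> \<open>In the variable z = s - k the zero-free strip is - D2 - k < Re z < D1 - k. Both
    closed ends lie inside it because \<delta> < D1 < D2.\<close>
  proof (rule expsum_bounded_below[of "\<lambda>m. ln (freq m)", OF strict_mono_ln_freq _ nonzero])
    show "ln (freq 0) > 0" using freq_gt_1[of 0] by (rule ln_gt_zero)
    fix z assume "- D2 - real k < Re z" "Re z < D1 - real k"
    then show "(\<Sum>m\<le>n. a m * exp (- z * of_real (ln (freq m)))) \<noteq> 0"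
      using no_zeros[of "z + of_nat k"] by (simp add: psiF_eq)
  qed (use delta D1_D2 in auto)
  then obtain e where e: "e > 0" "\<And>z. - \<delta> - real k \<le> Re z \<Longrightarrow> Re z \<le> \<delta> - real k \<Longrightarrow> norm (psiF a n z) \<ge> e"
    unfolding psiF_eq by blast
  \<comment> \<open>A lower bound in the strip for the leading term of the series.\<close>
  define c where "c = norm (conj_moment a n k) / fact k * e"
  have c0: "c > 0" using momk e by (simp add: c_def)
  have h0: "norm (CF_series_term a n k 0 s) \<ge> c" if "\<bar>Re s\<bar> \<le> \<delta>" for s
  proof -
    have "norm (psiF a n (s - of_nat k)) \<ge> e" using that by (intro e(2)) auto
    then have "norm (conj_moment a n k) / fact k * e \<le> norm (conj_moment a n k) / fact k * norm (psiF a n (s - of_nat k))"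
      by (intro mult_left_mono) auto
    then show ?thesis by (simp add: CF_series_term_def c_def norm_mult norm_divide)
  qed
  \<comment> \<open>The width \<delta> + 1 leaves room for the discs of radius 1/2 in Cauchy's
    inequality.\<close>
  obtain B0 where B0: "B0 \<ge> 0"
    "\<And>s. \<bar>Re s\<bar> \<le> \<delta> + 1 \<Longrightarrow> \<bar>Im s\<bar> \<ge> 1 \<Longrightarrow> norm (CF_series a n k s) \<le> B0 * exp ((freq n)\<^sup>2)"
    "\<And>s. \<bar>Re s\<bar> \<le> \<delta> + 1 \<Longrightarrow> \<bar>Im s\<bar> \<ge> 1 \<Longrightarrow> norm (CF_series a n k s - CF_series_term a n k 0 s) \<le> B0 * exp ((freq n)\<^sup>2) / \<bar>Im s\<bar>"
    using CF_series_bounds[of "\<delta> + 1" a n k] by blast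
  define M where "M = B0 * exp ((freq n)\<^sup>2)"
  have M0: "M \<ge> 0" using B0 by (simp add: M_def)
  \<comment> \<open>High up in the strip, Cauchy's inequality on radius 1/2 bounds the derivative of
    the series by 2 M, and the series itself is at least c / 2. So Re Digamma exceeds the modulus of
    the logarithmic derivative of the series by at least 1.\<close>
  obtain T1 where T1: "T1 \<ge> 1" "\<And>z. \<bar>Re z\<bar> \<le> \<delta> + real k \<Longrightarrow> \<bar>Im z\<bar> \<ge> T1 \<Longrightarrow> Re (Digamma z) \<ge> 2 * M / (c / 2) + 1"
    using Re_Digamma_large[of "\<delta> + real k" "2 * M / (c / 2) + 1"] by blast
  \<comment> \<open>T >= 2 keeps the Cauchy discs in |Im s| > 1, T >= T1 serves Digamma, and T >= 2
    M / c makes the error M / |Im s| at most c / 2.\<close>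
  define T where "T = T1 + 1 + 2 * M / c"
  have "2 * M / c \<ge> 0" using M0 c0 by simp
  then have T2: "T \<ge> 2" "T \<ge> T1" "T \<ge> 2 * M / c" using T1(1) unfolding T_def by linarith+
  define g where "g = (\<lambda>s. (-1) ^ k * Gamma (s - of_nat k) * CF_series a n k s)"
  define L where "L = (\<lambda>s. Digamma (s - of_nat k) + deriv (CF_series a n k) s / CF_series a n k s)"
  have hge: "norm (CF_series a n k s) \<ge> c / 2" if s: "\<bar>Re s\<bar> \<le> \<delta>" "\<bar>Im s\<bar> \<ge> T" for s
  proof -
    have "norm (CF_series a n k s - CF_series_term a n k 0 s) \<le> M / \<bar>Im s\<bar>"
      using B0(3)[of s] s T2 by (simp add: M_def)
    also have "\<dots> \<le> c / 2"
    proof -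
      have "2 * M / c \<le> \<bar>Im s\<bar>" "\<bar>Im s\<bar> > 0" using s T2 by linarith+
      then show ?thesis using c0 by (simp add: field_simps)
    qed
    finally have "norm (CF_series a n k s - CF_series_term a n k 0 s) \<le> c / 2" .
    moreover have "norm (CF_series_term a n k 0 s) \<le> norm (CF_series a n k s) + norm (CF_series a n k s - CF_series_term a n k 0 s)"
      using norm_triangle_ineq4[of "CF_series a n k s" "CF_series a n k s - CF_series_term a n k 0 s"] by simp
    ultimately show ?thesis using h0[OF s(1)] by linarith
  qed
  have dle: "norm (deriv (CF_series a n k) s) \<le> 2 * M" if s: "\<bar>Re s\<bar> \<le> \<delta>" "\<bar>Im s\<bar> \<ge> T" for s
  proof -
    have near: "\<bar>Re w\<bar> \<le> \<delta> + 1" "\<bar>Im w\<bar> > 1" if "norm (s - w) \<le> 1 / 2" for w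
    proof -
      have "\<bar>Re s - Re w\<bar> \<le> 1 / 2" "\<bar>Im s - Im w\<bar> \<le> 1 / 2"
        using abs_Re_le_cmod[of "s - w"] abs_Im_le_cmod[of "s - w"] that by simp_all
      then show "\<bar>Re w\<bar> \<le> \<delta> + 1" "\<bar>Im w\<bar> > 1" using s T2 by linarith+
    qed
    have hol: "CF_series a n k holomorphic_on cball s (1/2)"
      by (rule holomorphic_on_subset[OF CF_series_holomorphic]) (use near in \<open>auto simp: dist_norm\<close>)
    have "norm ((deriv ^^ 1) (CF_series a n k) s) \<le> fact 1 * M / (1/2) ^ 1"
    proof (rule Cauchy_inequality)
      show "CF_series a n k holomorphic_on ball s (1/2)"
        using hol ball_subset_cball holomorphic_on_subset by blast
      show "continuous_on (cball s (1/2)) (CF_series a n k)" using hol by (rule holomorphic_on_imp_continuous_on)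
      show "norm (CF_series a n k w) \<le> M" if "norm (s - w) = 1 / 2" for w
        unfolding M_def using near[of w] that by (intro B0(2)) auto
    qed simp
    then show ?thesis by simp
  qed
  show ?thesis
  proof (rule finite_exceptional_zeros[OF CF_holomorphic, where g = g and L = L and T = T])
    fix s assume s: "\<bar>Im s\<bar> \<ge> T"
    have "\<bar>Im s\<bar> \<ge> 1" "\<bar>Im (- cnj s)\<bar> \<ge> 1" using s T2 by auto
    then show "CF a n s = g s + cnj (g (- cnj s))"
      unfolding g_def using CF_eq_CF_part[of s a n] by (simp only: CF_part_eq_Gamma_mult_series[OF _ mom0])
  next
    fix s assume s: "\<bar>Re s\<bar> \<le> \<delta>" "\<bar>Im s\<bar> \<ge> T"
    have h_nz: "CF_series a n k s \<noteq> 0" using hge[OF s] c0 by auto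
    have im: "\<bar>Im (s - of_nat k)\<bar> \<ge> 1" using s T2 by simp
    show "g s \<noteq> 0" using h_nz Gamma_nonzero_of_Im[OF im] by (simp add: g_def)
    have dh: "(CF_series a n k has_field_derivative deriv (CF_series a n k) s) (at s)"
    proof (rule holomorphic_derivI[OF CF_series_holomorphic])
      show "open {s. \<bar>Im s\<bar> > 1}" by (intro open_Collect_less continuous_intros)
      show "s \<in> {s. \<bar>Im s\<bar> > 1}" using s T2 by simp
    qed
    have dG: "((\<lambda>s. Gamma (s - of_nat k)) has_field_derivative Gamma (s - of_nat k) * Digamma (s - of_nat k)) (at s)"
    proof -
      have "((\<lambda>s. s - of_nat k) has_field_derivative 1) (at s)" by (auto intro!: derivative_eq_intros)
      from DERIV_chain2[where g = "\<lambda>s. s - of_nat k", OF has_field_derivative_Gamma[OF not_nonpos_Int_of_Im[OF im]] this]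
      show ?thesis by simp
    qed
    show "(g has_field_derivative g s * L s) (at s)"
      unfolding g_def
      by (rule DERIV_cong[OF DERIV_mult[OF DERIV_cmult[OF dG] dh]]) (use h_nz in \<open>simp add: L_def field_simps\<close>)
    have "norm (deriv (CF_series a n k) s / CF_series a n k s) \<le> 2 * M / (c / 2)"
      unfolding norm_divide using dle[OF s] hge[OF s] c0 M0 by (intro frac_le) auto
    then have "\<bar>Re (deriv (CF_series a n k) s / CF_series a n k s)\<bar> \<le> 2 * M / (c / 2)"
      using abs_Re_le_cmod order_trans by blast
    moreover have "Re (Digamma (s - of_nat k)) \<ge> 2 * M / (c / 2) + 1"
      using s T2 by (intro T1(2)) auto
    ultimately show "Re (L s) > 0" unfolding L_def by simp
  qed (use delta in auto)
qed

end
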